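(* Let $m\in\mathbb{N}$, let $\phi\in L^1_{\mathrm{loc}}(\mathbb{R})^{m\times m}$ with $\phi(x)=\phi(x)^*$ for a.e. $x\in\mathbb{R}$, let $x_0\in\mathbb{R}$ and $\alpha_0=(I_m\;\,0)$. Let $U_\pm(\zeta,\cdot,x_0,\alpha_0)=\begin{pmatrix}u_{\pm,1}(\zeta,\cdot,x_0,\alpha_0)\\ u_{\pm,2}(\zeta,\cdot,x_0,\alpha_0)\end{pmatrix}$ be the Weyl--Titchmarsh solutions of the Dirac-type operator $D$ and $M^D_\pm(\zeta,x_0,\alpha_0)$ its half-line Weyl--Titchmarsh matrices, $\zeta\in\mathbb{C}\setminus\mathbb{R}$ (see context). Then, for $z=\zeta^2$, $\zeta\in\mathbb{C}\setminus\mathbb{R}$, the Weyl--Titchmarsh solutions $\psi_{\pm,j}(z,\cdot,x_0)$ of $H_j$, $j=1,2$, are given by $$\psi_{\pm,1}(z,\cdot,x_0)=u_{\pm,1}(\zeta,\cdot,x_0,\alpha_0),\qquad \psi_{\pm,2}(z,\cdot,x_0)=u_{\pm,2}(\zeta,\cdot,x_0,\alpha_0)\,M^D_\pm(\zeta,x_0,\alpha_0)^{-1},$$ and the generalized Dirichlet-type $m\times m$ Weyl--Titchmarsh functions $\widehat M_{\pm,0,j}(\cdot,x_0)$ of $H_j$, $j=1,2$, are given by $$\widehat M_{\pm,0,1}(z,x_0)=\zeta M^D_\pm(\zeta,x_0,\alpha_0),\qquad \widehat M_{\pm,0,2}(z,x_0)=-\zeta M^D_\pm(\zeta,x_0,\alpha_0)^{-1}.$$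 In particular, $$\widehat M_{\pm,0,1}(z,x_0)=\zeta M^D_\pm(\zeta,x_0,\alpha_0)=-z\,\widehat M_{\pm,0,2}(z,x_0)^{-1},\qquad z=\zeta^2,\ \zeta\in\mathbb{C}\setminus\mathbb{R}.$$
   Context: **Dirac side.** Let $\mathcal{D}=\begin{pmatrix}0&-I_m\frac{d}{dx}+\phi(x)\\ I_m\frac{d}{dx}+\phi(x)&0\end{pmatrix}$; $D$ is the maximal (self-adjoint) operator in $L^2(\mathbb{R})^{2m}$ associated with $\mathcal D$, i.e. $DU=\mathcal{D}U$ on $\{V\in L^2(\mathbb{R})^{2m}: V \text{ locally absolutely continuous},\ \mathcal{D}V\in L^2(\mathbb{R})^{2m}\}$. It has the form $D=\begin{pmatrix}0&A^*\\ A&0\end{pmatrix}$, where $Au=u'+\phi u$ is maximally defined in $L^2(\mathbb{R})^m$ and $A^*u=-u'+\phi u$ is also the maximally defined operator. Let $\Psi(\zeta,x,x_0,\alpha_0)=\begin{pmatrix}\vartheta_1&\varphi_1\\ \vartheta_2&\varphi_2\end{pmatrix}(\zeta,x,x_0,\alpha_0)$ be the $2m\times2m$ locally absolutely continuous solution of $\mathcal{D}\Psi=\zeta\Psi$ a.e. with $\Psi(\zeta,x_0,x_0,\alpha_0)=I_{2m}$. For $\zeta\in\mathbb{C}\setminus\mathbb{R}$ let $N(\zeta,\pm\infty)$ be the space of locally absolutely continuous $\mathbb{C}^{2m}$-valued $V$ on the half-line from $x_0$ to $\pm\infty$ that are square integrable there and satisfy $\mathcal{D}V=\zeta V$ a.e.;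 $\mathcal{D}$ is known to be in the limit point case at $\pm\infty$, so $\dim N(\zeta,\pm\infty)=m$. The $m\times m$ matrix $M^D_\pm(\zeta,x_0,\alpha_0)$ is determined by requiring that the $m$ columns of $U_\pm(\zeta,x,x_0,\alpha_0)=\begin{pmatrix}u_{\pm,1}\\ u_{\pm,2}\end{pmatrix}=\Psi(\zeta,x,x_0,\alpha_0)\begin{pmatrix}I_m\\ M^D_\pm(\zeta,x_0,\alpha_0)\end{pmatrix}$ (with $m\times m$ blocks $u_{\pm,1},u_{\pm,2}$) span $N(\zeta,\pm\infty)$. It is known that $M^D_\pm(\zeta,x_0,\alpha_0)$ is invertible for $\zeta\in\mathbb{C}\setminus\mathbb{R}$. **Schrödinger side.** $H_1=A^*A$, $H_2=AA^*$ in $L^2(\mathbb{R})^m$. Quasi-derivatives: $u^{[1,1]}=u'+\phi u$, $u^{[1,2]}=u'-\phi u$. The differential expressions are $\tau_ju=-(u^{[1,j]})'+(-1)^{j+1}\phi u^{[1,j]}$, and solutions of $\tau_ju=zu$ are understood as $u,u^{[1,j]}$ locally absolutely continuous with the equation holding a.e. Let $s_j(z,\cdot,x_0),c_j(z,\cdot,x_0)$ be the $m\times m$ solutions of $\tau_ju=zu$ with $s_j(z,x_0,x_0)=0$, $s_j^{[1,j]}(z,x_0,x_0)=I_m$, $c_j(z,x_0,x_0)=I_m$, $c_j^{[1,j]}(z,x_0,x_0)=0$. For $z\in\mathbb{C}\setminus[0,\infty)$, a Weyl--Titchmarsh solution $\psi_{\pm,j}(z,\cdot,x_0)$ of $H_j$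 is an $m\times m$ matrix solution of $\tau_j\psi=z\psi$ whose columns are square integrable on the half-line from $x_0$ to $\pm\infty$ and which is normalized by $\psi_{\pm,j}(z,x_0,x_0)=I_m$; the generalized Dirichlet-type Weyl--Titchmarsh function is $\widehat M_{\pm,0,j}(z,x_0)=\psi_{\pm,j}^{[1,j]}(z,x_0,x_0)$, equivalently $\psi_{\pm,j}(z,\cdot,x_0)=c_j(z,\cdot,x_0)+s_j(z,\cdot,x_0)\widehat M_{\pm,0,j}(z,x_0)$. *)

theory Defs
  imports "HOL-Analysis.Analysis"
begin

subsection \<open>Absolute continuity\<close>

definition abs_cont_on :: "real set \<Rightarrow> (real \<Rightarrow> 'a::real_normed_vector) \<Rightarrow> bool" where
  "abs_cont_on S f \<longleftrightarrow>
     (\<forall>\<epsilon>>0. \<exists>\<delta>>0. \<forall>\<D> T. \<D> division_of T \<and> T \<subseteq> S \<and> (\<Sum>K\<in>\<D>. Sup K - Inf K) < \<delta> \<longrightarrow>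
        (\<Sum>K\<in>\<D>. norm (f (Sup K) - f (Inf K))) < \<epsilon>)"

definition loc_abs_cont_on :: "real set \<Rightarrow> (real \<Rightarrow> 'a::real_normed_vector) \<Rightarrow> bool" where
  "loc_abs_cont_on I f \<longleftrightarrow> (\<forall>a b. {a..b} \<subseteq> I \<longrightarrow> abs_cont_on {a..b} f)"

definition square_integrable_on :: "real set \<Rightarrow> (real \<Rightarrow> 'a::real_normed_vector) \<Rightarrow> bool" where
  "square_integrable_on I f \<longleftrightarrow>
     set_borel_measurable lebesgue I f \<and> set_integrable lebesgue I (\<lambda>x. (norm (f x))\<^sup>2)"

datatype line_end = PlusInf | MinusInf

fun half_line :: "line_end \<Rightarrow> real \<Rightarrow> real set" where
  "half_line PlusInf x0 = {x0..}"
| "half_line MinusInf x0 = {..x0}"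


subsection \<open>Matrices and blocks\<close>

definition hermitian :: "complex^'m^'m \<Rightarrow> bool" where
  "hermitian A \<longleftrightarrow> transpose (map_matrix cnj A) = A"

text \<open>
  A matrix is a vector of rows. The three functions below therefore apply both to vectors in
  \<open>\<complex>\<^sup>2\<^sup>m\<close> (entries complex) and to matrices with \<open>2m\<close> rows (entries row vectors).
\<close>

definition stack :: "'a^'m \<Rightarrow> 'a^'m \<Rightarrow> 'a^('m + 'm)" where
  "stack A B = (\<chi> i. case i of Inl k \<Rightarrow> A $ k | Inr k \<Rightarrow> B $ k)"

definition upper :: "'a^('m + 'm) \<Rightarrow> 'a^'m" where
  "upper A = (\<chi> k. A $ Inl k)"

definition lower :: "'a^('m + 'm) \<Rightarrow> 'a^'m" where
  "lower A = (\<chi> k. A $ Inr k)"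


subsection \<open>The Dirac-type expression\<close>

text \<open>\<open>P\<close>, \<open>V\<close>, \<open>V'\<close> are the values at one point of the potential, of the function, and of its
  derivative.\<close>

definition dirac_expr ::
  "complex^'m^'m \<Rightarrow> complex^('m + 'm) \<Rightarrow> complex^('m + 'm) \<Rightarrow> complex^('m + 'm)" where
  "dirac_expr P V V' = stack (- lower V' + P *v lower V) (upper V' + P *v upper V)"

definition dirac_solution ::
  "(real \<Rightarrow> complex^'m^'m) \<Rightarrow> complex \<Rightarrow> real set \<Rightarrow> (real \<Rightarrow> complex^('m + 'm)) \<Rightarrow> bool" where
  "dirac_solution \<phi> \<zeta> I V \<longleftrightarrow>
     loc_abs_cont_on I V \<and>
     (AE x in lebesgue. x \<in> I \<longrightarrow>
        (\<exists>V'. (V has_vector_derivative V') (at x within I) \<and> dirac_expr (\<phi> x) (V x) V' = \<zeta> *s V x))"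

text \<open>The normalization at \<open>x\<^sub>0\<close> is the one belonging to the boundary data \<open>\<alpha>\<^sub>0 = (I\<^sub>m 0)\<close>.\<close>

definition dirac_fundamental ::
  "(real \<Rightarrow> complex^'m^'m) \<Rightarrow> complex \<Rightarrow> real \<Rightarrow> (real \<Rightarrow> complex^('m + 'm)^('m + 'm)) \<Rightarrow> bool" where
  "dirac_fundamental \<phi> \<zeta> x0 \<Psi> \<longleftrightarrow>
     (\<forall>k. dirac_solution \<phi> \<zeta> UNIV (\<lambda>x. column k (\<Psi> x))) \<and> \<Psi> x0 = mat 1"

text \<open>The space \<open>N(\<zeta>, \<plusminus>\<infinity>)\<close>. Its members are total functions of which only the values on the
  half-line matter; they are compared on the half-line only.\<close>

definition dirac_l2_solutions ::
  "(real \<Rightarrow> complex^'m^'m) \<Rightarrow> line_end \<Rightarrow> complex \<Rightarrow> real \<Rightarrow> (real \<Rightarrow> complex^('m + 'm)) set" where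
  "dirac_l2_solutions \<phi> s \<zeta> x0 =
     {V. dirac_solution \<phi> \<zeta> (half_line s x0) V \<and> square_integrable_on (half_line s x0) V}"

definition dirac_weyl_solution ::
  "(real \<Rightarrow> complex^('m + 'm)^('m + 'm)) \<Rightarrow> complex^'m^'m \<Rightarrow> real \<Rightarrow> complex^'m^('m + 'm)" where
  "dirac_weyl_solution \<Psi> M x = \<Psi> x ** stack (mat 1) M"

text \<open>\<open>M\<close> is the Weyl--Titchmarsh matrix \<open>M\<^sup>D\<^sub>\<plusminus>(\<zeta>, x\<^sub>0, \<alpha>\<^sub>0)\<close>: the columns of
  \<open>U\<^sub>\<plusminus>\<close> lie in \<open>N(\<zeta>, \<plusminus>\<infinity>)\<close>, and every element of that space is
  a linear combination \<open>U\<^sub>\<plusminus> c\<close> of them.\<close>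

definition dirac_weyl_matrix ::
  "(real \<Rightarrow> complex^'m^'m) \<Rightarrow> line_end \<Rightarrow> complex \<Rightarrow> real \<Rightarrow>
   (real \<Rightarrow> complex^('m + 'm)^('m + 'm)) \<Rightarrow> complex^'m^'m \<Rightarrow> bool" where
  "dirac_weyl_matrix \<phi> s \<zeta> x0 \<Psi> M \<longleftrightarrow>
     (\<forall>k. (\<lambda>x. column k (dirac_weyl_solution \<Psi> M x)) \<in> dirac_l2_solutions \<phi> s \<zeta> x0) \<and>
     (\<forall>V \<in> dirac_l2_solutions \<phi> s \<zeta> x0. \<exists>c. \<forall>x \<in> half_line s x0.
        V x = dirac_weyl_solution \<Psi> M x *v c)"


subsection \<open>The Schroedinger operators \<open>H\<^sub>1 = A\<^sup>* A\<close> and \<open>H\<^sub>2 = A A\<^sup>*\<close>\<close>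

text \<open>\<open>v\<close> is the quasi-derivative \<open>u\<^bsup>[1,j]\<^esup> = u' + (-1)\<^bsup>j+1\<^esup> \<phi> u\<close> of the matrix function \<open>u\<close>.
  The defining formula only makes sense almost everywhere; the absolutely continuous representative
  is meant, so that point values such as \<open>u\<^bsup>[1,j]\<^esup>(x\<^sub>0)\<close> are defined.\<close>

definition is_quasi_deriv ::
  "(real \<Rightarrow> complex^'m^'m) \<Rightarrow> nat \<Rightarrow> (real \<Rightarrow> complex^'m^'m) \<Rightarrow> (real \<Rightarrow> complex^'m^'m) \<Rightarrow> bool" where
  "is_quasi_deriv \<phi> j u v \<longleftrightarrow>
     loc_abs_cont_on UNIV u \<and> loc_abs_cont_on UNIV v \<and>
     (AE x in lebesgue. \<exists>u'. (u has_vector_derivative u') (at x) \<and>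
        v x = u' + (-1) ^ (j + 1) *\<^sub>R (\<phi> x ** u x))"

definition quasi_deriv ::
  "(real \<Rightarrow> complex^'m^'m) \<Rightarrow> nat \<Rightarrow> (real \<Rightarrow> complex^'m^'m) \<Rightarrow> real \<Rightarrow> complex^'m^'m" where
  "quasi_deriv \<phi> j u = (THE v. is_quasi_deriv \<phi> j u v)"

text \<open>Solutions of \<open>\<tau>\<^sub>j u = z u\<close>, where
  \<open>\<tau>\<^sub>j u = - (u\<^bsup>[1,j]\<^esup>)' + (-1)\<^bsup>j+1\<^esup> \<phi> u\<^bsup>[1,j]\<^esup>\<close>.\<close>

definition schroedinger_solution ::
  "(real \<Rightarrow> complex^'m^'m) \<Rightarrow> nat \<Rightarrow> complex \<Rightarrow> (real \<Rightarrow> complex^'m^'m) \<Rightarrow> bool" where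
  "schroedinger_solution \<phi> j z u \<longleftrightarrow>
     (\<exists>v. is_quasi_deriv \<phi> j u v \<and>
        (AE x in lebesgue. \<exists>v'. (v has_vector_derivative v') (at x) \<and>
           - v' + (-1) ^ (j + 1) *\<^sub>R (\<phi> x ** v x) = map_matrix ((*) z) (u x)))"

definition is_weyl_solution ::
  "(real \<Rightarrow> complex^'m^'m) \<Rightarrow> nat \<Rightarrow> line_end \<Rightarrow> complex \<Rightarrow> real \<Rightarrow> (real \<Rightarrow> complex^'m^'m) \<Rightarrow> bool" where
  "is_weyl_solution \<phi> j s z x0 \<psi> \<longleftrightarrow>
     schroedinger_solution \<phi> j z \<psi> \<and>
     (\<forall>k. square_integrable_on (half_line s x0) (\<lambda>x. column k (\<psi> x))) \<and>
     \<psi> x0 = mat 1"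

text \<open>The generalized Dirichlet-type Weyl--Titchmarsh function \<open>\<psi>\<^bsup>[1,j]\<^esup>(z, x\<^sub>0, x\<^sub>0)\<close>, where \<open>\<psi>\<close>
  is the unique Weyl--Titchmarsh solution.\<close>

definition weyl_function ::
  "(real \<Rightarrow> complex^'m^'m) \<Rightarrow> nat \<Rightarrow> line_end \<Rightarrow> complex \<Rightarrow> real \<Rightarrow> complex^'m^'m" where
  "weyl_function \<phi> j s z x0 = quasi_deriv \<phi> j (THE \<psi>. is_weyl_solution \<phi> j s z x0 \<psi>) x0"

end

theory Submission
  imports Defs
begin

text \<open>
  A pair \<open>(f, g)\<close> with \<open>f' = \<alpha> g - \<phi> f\<close> and \<open>g' = \<phi> g - \<beta> f\<close> is a solution of the Dirac-type
  system for \<open>\<alpha> = \<beta> = \<zeta>\<close>, and a solution of \<open>\<tau>\<^sub>1 f = z f\<close> with its quasi-derivative for \<open>\<alpha> = 1\<close>,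
  \<open>\<beta> = z\<close>. Rescaling \<open>g\<close> by \<open>\<zeta>\<close> turns the first system into the second one; exchanging \<open>f\<close> and
  \<open>g\<close> replaces \<open>\<phi>\<close> by \<open>- \<phi>\<close>, hence \<open>\<tau>\<^sub>1\<close> by \<open>\<tau>\<^sub>2\<close>.
  So the theorem reduces to three facts.
  \<^item> Initial values at one point determine the pair, also when \<open>\<phi>\<close> is merely locally integrable.
  \<^item> If \<open>f\<close> is square integrable on the half-line, then so is its quasi-derivative \<open>g\<close>. Integrating
    \<open>(Re \<langle>f, g\<rangle>)' = |g|\<^sup>2 - Re z |f|\<^sup>2\<close> shows that an unbounded \<open>F = \<integral> |g|\<^sup>2\<close> forces
    \<open>F \<le> 2 |f| |g|\<close> eventually; then \<open>x - \<integral> |f|\<^sup>2 + 1 / F\<close> is nonincreasing, which is absurd.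
  \<^item> The Weyl--Titchmarsh matrix is invertible: \<open>Im \<langle>f, g\<rangle>\<close> (up to sign) has derivative
    \<open>- Im \<zeta> (|f|\<^sup>2 + |g|\<^sup>2)\<close>, so a square integrable Dirac solution with \<open>g(x\<^sub>0) = 0\<close> vanishes at \<open>x\<^sub>0\<close>.
\<close>

subsection \<open>Absolutely continuous functions\<close>

text \<open>
  Intervals tagged outside the null set \<open>N\<close> are handled by differentiability. Those tagged in \<open>N\<close> are
  kept inside an open set of small measure, so absolute continuity bounds their contribution.
\<close>

lemma has_integral_abs_cont_on:
  fixes f :: "real \<Rightarrow> 'a::banach"
  assumes ac: "abs_cont_on {a..b} f" and "a \<le> b" and N: "negligible N"
    and deriv: "\<And>x. x \<in> {a..b} - N \<Longrightarrow> (f has_vector_derivative f' x) (at x within {a..b})"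
  shows "(f' has_integral (f b - f a)) {a..b}"
proof (cases "a = b")
  case True
  then show ?thesis using has_integral_refl(2)[of f' a] by simp
next
  case False
  with \<open>a \<le> b\<close> have "a < b" by simp
  \<comment> \<open>With value 0 on \<open>N\<close>, a tag in \<open>N\<close> adds nothing to the
    Riemann sum, so its error is just the increment of \<open>f\<close>.\<close>
  define g where "g x = (if x \<in> N then 0 else f' x)" for x
  have "(g has_integral (f b - f a)) (cbox a b)"
    unfolding has_integral
  proof (intro allI impI)
    fix e :: real assume "e > 0"
    define \<eta> where "\<eta> = e / (2 * (b - a))"
    have "\<eta> > 0" using \<open>e > 0\<close> \<open>a < b\<close> by (simp add: \<eta>_def)
    have "\<forall>x. \<exists>d>0. x \<in> {a..b} - N \<longrightarrow> (\<forall>y\<in>{a..b}. norm (y-x) < d \<longrightarrow>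
            norm (f y - f x - (y-x) *\<^sub>R f' x) \<le> \<eta> * norm (y-x))"
    proof
      fix x
      show "\<exists>d>0. x \<in> {a..b} - N \<longrightarrow> (\<forall>y\<in>{a..b}. norm (y-x) < d \<longrightarrow>
            norm (f y - f x - (y-x) *\<^sub>R f' x) \<le> \<eta> * norm (y-x))"
      proof (cases "x \<in> {a..b} - N")
        case True
        then show ?thesis
          using deriv[OF True, unfolded has_vector_derivative_def has_derivative_within_alt] \<open>\<eta> > 0\<close>
          by blast
      qed (auto intro: exI[of _ 1])
    qed
    then obtain d where d: "\<And>x. 0 < d x"
      "\<And>x y. \<lbrakk>x \<in> {a..b} - N; y \<in> {a..b}; norm (y-x) < d x\<rbrakk>
                        \<Longrightarrow> norm (f y - f x - (y-x) *\<^sub>R f' x) \<le> \<eta> * norm (y-x)"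
      by metis
    obtain \<delta> where "\<delta> > 0" and \<delta>: "\<And>\<D> T. \<D> division_of T \<Longrightarrow> T \<subseteq> {a..b} \<Longrightarrow>
        (\<Sum>K\<in>\<D>. Sup K - Inf K) < \<delta> \<Longrightarrow> (\<Sum>K\<in>\<D>. norm (f (Sup K) - f (Inf K))) < e / 2"
      using ac \<open>e > 0\<close> unfolding abs_cont_on_def by (metis half_gt_zero)
    have Nnull: "N \<in> null_sets lebesgue" using N by (simp add: negligible_iff_null_sets)
    \<comment> \<open>Balls around points of \<open>N\<close> will be taken inside \<open>G\<close>,
      so intervals tagged in \<open>N\<close> have total length below \<open>\<delta>\<close>,
      whatever \<open>f'\<close> does there.\<close>
    obtain G where G: "open G" "N \<subseteq> G" "(G - N) \<in> lmeasurable" "emeasure lebesgue (G - N) < ennreal \<delta>"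
      using sets_lebesgue_outer_open[OF null_setsD2[OF Nnull] \<open>\<delta> > 0\<close>] by blast
    have "(G - N) \<union> N = G" using G(2) by blast
    then have "emeasure lebesgue G < ennreal \<delta>"
      using emeasure_Un_null_set[OF fmeasurableD[OF G(3)] Nnull] G(4) by metis
    then have Gm: "G \<in> lmeasurable" and G\<delta>: "measure lebesgue G < \<delta>"
    proof -
      assume *: "emeasure lebesgue G < ennreal \<delta>"
      then show "G \<in> lmeasurable"
        using G(1) order.strict_trans[OF * ennreal_less_top] by (intro fmeasurableI) auto
      then show "measure lebesgue G < \<delta>"
        using * by (simp add: emeasure_eq_measure2 ennreal_less_iff)
    qed
    have "\<forall>x. \<exists>r>0. x \<in> N \<longrightarrow> ball x r \<subseteq> G"
      using G(1,2) unfolding open_contains_ball by (meson subsetD zero_less_one)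
    then obtain r where r: "\<And>x. 0 < r x" "\<And>x. x \<in> N \<Longrightarrow> ball x (r x) \<subseteq> G"
      by metis
    define \<gamma> where "\<gamma> x = ball x (if x \<in> N then r x else d x)" for x
    have gauge: "gauge \<gamma>" unfolding \<gamma>_def using d(1) r(1) by (intro gauge_ball_dependent) auto
    have bound: "norm ((\<Sum>(x, K)\<in>p. measure lborel K *\<^sub>R g x) - (f b - f a)) < e"
      if ptag: "p tagged_division_of cbox a b" and fine: "\<gamma> fine p" for p
    proof -
      have "finite p" using ptag by blast
      \<comment> \<open>Each of the two classes of tags is allotted an error of
        \<open>e / 2\<close>.\<close>
      define p1 where "p1 = {(x,K) \<in> p. x \<in> N}"
      define p2 where "p2 = {(x,K) \<in> p. x \<notin> N}"
      have p12: "p = p1 \<union> p2" "p1 \<inter> p2 = {}" "finite p1" "finite p2"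
        using \<open>finite p\<close> unfolding p1_def p2_def by (auto intro: finite_subset[OF _ \<open>finite p\<close>])
      have ba: "b - a = (\<Sum>(x,K)\<in>p. Sup K - Inf K)" "f b - f a = (\<Sum>(x,K)\<in>p. f(Sup K) - f(Inf K))"
        using additive_tagged_division_1[where f= "\<lambda>x. x"] additive_tagged_division_1[where f= f]
              \<open>a \<le> b\<close> ptag by auto
      have K: "\<exists>u v. K = {u..v} \<and> u \<le> v \<and> u \<in> K \<and> v \<in> K \<and> Sup K = v \<and> Inf K = u \<and> x \<in> K \<and> K \<subseteq> {a..b}
                 \<and> measure lborel K = v - u"
        if q: "(x, K) \<in> p" for x K
      proof -
        have "x \<in> K" "K \<subseteq> {a..b}" using tagged_division_ofD(2,3)[OF ptag q] by auto
        moreover obtain u v where "K = {u..v}" using tagged_division_ofD(4)[OF ptag q] by auto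
        ultimately show ?thesis by (auto intro!: exI[of _ u] exI[of _ v])
      qed
      have p1part: "p1 tagged_partial_division_of {a..b}"
        by (rule tagged_partial_division_subset[of p])
          (use ptag p12 in \<open>auto simp: tagged_division_of_def\<close>)
      then have p1div: "snd ` p1 division_of \<Union>(snd ` p1)"
        by (rule partial_division_of_tagged_division)
      have p1tag: "p1 tagged_division_of \<Union>(snd ` p1)"
        by (rule tagged_partial_division_of_Union_self[OF p1part])
      have sub: "\<Union>(snd ` p1) \<subseteq> {a..b}" using K p12 by fastforce
      have subG: "\<Union>(snd ` p1) \<subseteq> G"
      proof -
        have "K \<subseteq> G" if "(x, K) \<in> p1" for x K
        proof -
          have "x \<in> N" "(x, K) \<in> p" using that by (auto simp: p1_def)
          then show ?thesis using fine r(2)[of x] unfolding fine_def \<gamma>_def by fastforce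
        qed
        then show ?thesis by fastforce
      qed
      have "(\<Sum>K\<in>snd ` p1. Sup K - Inf K) = (\<Sum>K\<in>snd ` p1. measure lebesgue K)"
      proof (rule sum.cong)
        fix k assume "k \<in> snd ` p1"
        then obtain x where "(x,k) \<in> p" by (auto simp: p1_def)
        from K[OF this] obtain u v where "k = {u..v}" "u \<le> v" by blast
        then show "Sup k - Inf k = measure lebesgue k" by (simp add: measure_completion)
      qed simp
      also have "\<dots> = measure lebesgue (\<Union>(snd ` p1))" by (rule content_division[OF p1div])
      also have "\<dots> \<le> measure lebesgue G"
        by (rule measure_mono_fmeasurable[OF subG _ Gm]) (use p1div lmeasurable_division in blast)
      also have "\<dots> < \<delta>" by (rule G\<delta>)
      finally have "(\<Sum>K\<in>snd ` p1. norm (f (Sup K) - f (Inf K))) < e / 2"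
        by (rule \<delta>[OF p1div sub])
      \<comment> \<open>Passing from intervals to tagged pairs needs a summand that vanishes on
        every interval with empty interior. One-point intervals satisfy this by themselves; the
        guard covers the empty set, whose \<open>Sup\<close> and \<open>Inf\<close> say
        nothing.\<close>
      also have "(\<Sum>K\<in>snd ` p1. norm (f (Sup K) - f (Inf K)))
          = (\<Sum>K\<in>snd ` p1. if K = {} then 0 else norm (f (Sup K) - f (Inf K)))"
        using p1div by (intro sum.cong) auto
      also have "\<dots> = (\<Sum>(x,K)\<in>p1. if K = {} then 0 else norm (f (Sup K) - f (Inf K)))"
        by (rule sum.over_tagged_division_lemma[OF p1tag, symmetric]) (auto simp: not_less)
      also have "\<dots> = (\<Sum>(x,K)\<in>p1. norm (f (Sup K) - f (Inf K)))"
        by (intro sum.cong) (use tagged_division_ofD(2)[OF p1tag] in fastforce)+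
      finally have S1: "(\<Sum>(x,K)\<in>p1. norm (f (Sup K) - f (Inf K))) < e / 2" .
      have T1: "norm (\<Sum>(x,K)\<in>p1. measure lborel K *\<^sub>R g x - (f (Sup K) - f (Inf K))) < e / 2"
      proof (rule le_less_trans[OF _ S1], rule sum_norm_le)
        fix q assume "q \<in> p1"
        then show "norm (case q of (x, K) \<Rightarrow> measure lborel K *\<^sub>R g x - (f (Sup K) - f (Inf K)))
            \<le> (case q of (x, K) \<Rightarrow> norm (f (Sup K) - f (Inf K)))"
          by (auto simp: p1_def g_def norm_minus_commute)
      qed
      have "norm (\<Sum>(x,K)\<in>p2. measure lborel K *\<^sub>R g x - (f (Sup K) - f (Inf K)))
          \<le> (\<Sum>(x,K)\<in>p2. \<eta> * (Sup K - Inf K))"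
      proof (rule sum_norm_le, safe)
        fix x K assume q: "(x, K) \<in> p2"
        then have xp: "(x, K) \<in> p" and "x \<notin> N" by (auto simp: p2_def)
        obtain u v where uv: "K = {u..v}" "u \<le> v" "Sup K = v" "Inf K = u" "x \<in> K" "K \<subseteq> {a..b}"
          "measure lborel K = v - u" "u \<in> K" "v \<in> K" using K[OF xp] by blast
        have ball: "K \<subseteq> ball x (d x)" using fine xp \<open>x \<notin> N\<close> unfolding fine_def \<gamma>_def by fastforce
        have x: "x \<in> {a..b} - N" using uv \<open>x \<notin> N\<close> by auto
        \<comment> \<open>Straddle estimate: the increment is routed through the tag
          \<open>x\<close>. Since \<open>x\<close> lies between \<open>u\<close> and
          \<open>v\<close>, the two errors add up to at most
          \<open>\<eta> * (v - u)\<close>.\<close>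
        have "norm ((v - u) *\<^sub>R f' x - (f v - f u))
            = norm ((f u - f x - (u - x) *\<^sub>R f' x) - (f v - f x - (v - x) *\<^sub>R f' x))"
          by (auto simp: algebra_simps)
        also have "\<dots> \<le> norm (f u - f x - (u - x) *\<^sub>R f' x) + norm (f v - f x - (v - x) *\<^sub>R f' x)"
          by (rule norm_triangle_ineq4)
        also have "\<dots> \<le> \<eta> * norm (u - x) + \<eta> * norm (v - x)"
          using uv subsetD[OF ball uv(8)] subsetD[OF ball uv(9)]
          by (intro add_mono d(2)[OF x]) (auto simp: dist_real_def)
        also have "\<dots> = \<eta> * (v - u)" using uv by (auto simp: algebra_simps)
        finally show "norm (measure lborel K *\<^sub>R g x - (f (Sup K) - f (Inf K))) \<le> \<eta> * (Sup K - Inf K)"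
          using \<open>x \<notin> N\<close> uv by (simp add: g_def)
      qed
      also have "\<dots> \<le> (\<Sum>(x,K)\<in>p. \<eta> * (Sup K - Inf K))"
      proof (rule sum_mono2[OF \<open>finite p\<close>])
        show "p2 \<subseteq> p" using p12 by auto
        fix q assume "q \<in> p - p2"
        then have "(fst q, snd q) \<in> p" by simp
        from K[OF this] have "Inf (snd q) \<le> Sup (snd q)" by (elim exE conjE) simp
        then show "0 \<le> (case q of (x, K) \<Rightarrow> \<eta> * (Sup K - Inf K))"
          using \<open>\<eta> > 0\<close> by (simp add: split_def)
      qed
      also have "\<dots> = \<eta> * (b - a)" by (simp add: ba(1) sum_distrib_left split_def)
      also have "\<dots> = e / 2"
      proof -
        have eq: "e / (2 * c) * c = e / 2" if "c \<noteq> 0" for c using that by simp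
        show ?thesis unfolding \<eta>_def by (rule eq) (use \<open>a < b\<close> in simp)
      qed
      finally have T2: "norm (\<Sum>(x,K)\<in>p2. measure lborel K *\<^sub>R g x - (f (Sup K) - f (Inf K))) \<le> e / 2" .
      have "(\<Sum>(x, K)\<in>p. measure lborel K *\<^sub>R g x) - (f b - f a)
          = (\<Sum>(x,K)\<in>p. measure lborel K *\<^sub>R g x - (f (Sup K) - f (Inf K)))"
        unfolding ba(2) by (simp add: sum_subtractf split_def)
      also have "\<dots> = (\<Sum>(x,K)\<in>p1. measure lborel K *\<^sub>R g x - (f (Sup K) - f (Inf K)))
          + (\<Sum>(x,K)\<in>p2. measure lborel K *\<^sub>R g x - (f (Sup K) - f (Inf K)))"
        unfolding p12(1) by (rule sum.union_disjoint[OF p12(3,4,2)])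
      finally have eq: "(\<Sum>(x, K)\<in>p. measure lborel K *\<^sub>R g x) - (f b - f a)
          = (\<Sum>(x,K)\<in>p1. measure lborel K *\<^sub>R g x - (f (Sup K) - f (Inf K)))
          + (\<Sum>(x,K)\<in>p2. measure lborel K *\<^sub>R g x - (f (Sup K) - f (Inf K)))" .
      show ?thesis
        unfolding eq using add_less_le_mono[OF T1 T2]
        by (intro le_less_trans[OF norm_triangle_ineq]) simp
    qed
    show "\<exists>\<gamma>. gauge \<gamma> \<and> (\<forall>p. p tagged_division_of cbox a b \<and> \<gamma> fine p \<longrightarrow>
        norm ((\<Sum>(x, K)\<in>p. measure lborel K *\<^sub>R g x) - (f b - f a)) < e)"
      by (intro exI[of _ \<gamma>] conjI allI impI gauge; elim conjE) (rule bound)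
  qed
  then have "(f' has_integral (f b - f a)) (cbox a b)"
    by (rule has_integral_spike[OF N, rotated]) (auto simp: g_def)
  then show ?thesis by simp
qed

section \<open>Continuity and closure properties of absolute continuity\<close>

lemma abs_cont_on_imp_continuous_on:
  assumes "abs_cont_on {a..b} f"
  shows "continuous_on {a..b} f"
  unfolding continuous_on_iff
proof (intro ballI allI impI)
  fix x e :: real assume x: "x \<in> {a..b}" and "e > 0"
  then obtain \<delta> where "\<delta> > 0" and \<delta>: "\<And>\<D> T. \<D> division_of T \<Longrightarrow> T \<subseteq> {a..b} \<Longrightarrow>
        (\<Sum>K\<in>\<D>. Sup K - Inf K) < \<delta> \<Longrightarrow> (\<Sum>K\<in>\<D>. norm (f (Sup K) - f (Inf K))) < e"
    using assms unfolding abs_cont_on_def by metis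
  have *: "norm (f v - f u) < e" if "u \<in> {a..b}" "v \<in> {a..b}" "u \<le> v" "v - u < \<delta>" for u v
  proof -
    have "{cbox u v} division_of cbox u v"
      using that by (intro division_of_self) auto
    from \<delta>[OF this] show ?thesis using that by auto
  qed
  have "dist (f y) (f x) < e" if "y \<in> {a..b}" "dist y x < \<delta>" for y
  proof (cases "x \<le> y")
    case True
    then show ?thesis using *[OF x that(1)] that(2) by (simp add: dist_norm)
  next
    case False
    then show ?thesis using *[OF that(1) x] that(2) by (simp add: dist_norm norm_minus_commute)
  qed
  with \<open>\<delta> > 0\<close> show "\<exists>d>0. \<forall>x'\<in>{a..b}. dist x' x < d \<longrightarrow> dist (f x') (f x) < e" by blast
qed

lemma division_endpoints:
  fixes T :: "real set"
  assumes "\<D> division_of T" "K \<in> \<D>"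
  shows "Sup K \<in> T" "Inf K \<in> T"
proof -
  obtain u v where "K = cbox u v" "K \<noteq> {}" "K \<subseteq> T"
    using division_ofD(2-4)[OF assms] by auto
  then show "Sup K \<in> T" "Inf K \<in> T" by auto
qed

text \<open>The common source of the closure properties below: a bound on single increments can be
  summed over any division, and one \<open>\<delta>\<close> serves both dominating
  functions.\<close>

lemma abs_cont_on_dominated:
  assumes f: "abs_cont_on S f" and g: "abs_cont_on S g" and "C \<ge> 0"
    and le: "\<And>x y. x \<in> S \<Longrightarrow> y \<in> S \<Longrightarrow> norm (h y - h x) \<le> C * (norm (f y - f x) + norm (g y - g x))"
  shows "abs_cont_on S h"
  unfolding abs_cont_on_def
proof (intro allI impI)
  fix e :: real assume "e > 0"
  \<comment> \<open>The denominator \<open>C + 1\<close> also covers \<open>C = 0\<close> and makes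
    the final estimate strict.\<close>
  define e' where "e' = e / (C + 1) / 2"
  have "e' > 0" using \<open>e > 0\<close> \<open>C \<ge> 0\<close> by (simp add: e'_def)
  obtain \<delta>1 where "\<delta>1 > 0" and \<delta>1: "\<And>\<D> T. \<D> division_of T \<Longrightarrow> T \<subseteq> S \<Longrightarrow>
        (\<Sum>K\<in>\<D>. Sup K - Inf K) < \<delta>1 \<Longrightarrow> (\<Sum>K\<in>\<D>. norm (f (Sup K) - f (Inf K))) < e'"
    using f \<open>e' > 0\<close> unfolding abs_cont_on_def by metis
  obtain \<delta>2 where "\<delta>2 > 0" and \<delta>2: "\<And>\<D> T. \<D> division_of T \<Longrightarrow> T \<subseteq> S \<Longrightarrow>
        (\<Sum>K\<in>\<D>. Sup K - Inf K) < \<delta>2 \<Longrightarrow> (\<Sum>K\<in>\<D>. norm (g (Sup K) - g (Inf K))) < e'"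
    using g \<open>e' > 0\<close> unfolding abs_cont_on_def by metis
  have "(\<Sum>K\<in>\<D>. norm (h (Sup K) - h (Inf K))) < e"
    if "\<D> division_of T" "T \<subseteq> S" "(\<Sum>K\<in>\<D>. Sup K - Inf K) < min \<delta>1 \<delta>2" for \<D> T
  proof -
    have "(\<Sum>K\<in>\<D>. norm (h (Sup K) - h (Inf K)))
        \<le> (\<Sum>K\<in>\<D>. C * (norm (f (Sup K) - f (Inf K)) + norm (g (Sup K) - g (Inf K))))"
      using division_endpoints[OF that(1)] that(2) by (intro sum_mono le) auto
    also have "\<dots> = C * ((\<Sum>K\<in>\<D>. norm (f (Sup K) - f (Inf K))) + (\<Sum>K\<in>\<D>. norm (g (Sup K) - g (Inf K))))"
      by (simp add: sum_distrib_left sum.distrib distrib_left)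
    also have "\<dots> \<le> C * (e' + e')"
      using \<delta>1[OF that(1,2)] \<delta>2[OF that(1,2)] that(3) \<open>C \<ge> 0\<close>
      by (intro mult_left_mono add_mono) auto
    also have "e' + e' = e / (C + 1)" unfolding e'_def by (rule field_sum_of_halves)
    also have "C * (e / (C + 1)) = e * (C / (C + 1))" by simp
    also have "\<dots> < e * 1" using \<open>e > 0\<close> \<open>C \<ge> 0\<close> by (intro mult_strict_left_mono) auto
    also have "\<dots> = e" by simp
    finally show ?thesis .
  qed
  then show "\<exists>\<delta>>0. \<forall>\<D> T. \<D> division_of T \<and> T \<subseteq> S \<and> (\<Sum>K\<in>\<D>. Sup K - Inf K) < \<delta> \<longrightarrow>
        (\<Sum>K\<in>\<D>. norm (h (Sup K) - h (Inf K))) < e"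
    using \<open>\<delta>1 > 0\<close> \<open>\<delta>2 > 0\<close> by (intro exI[of _ "min \<delta>1 \<delta>2"]) auto
qed

lemma abs_cont_on_linear:
  assumes "bounded_linear L" "abs_cont_on S f"
  shows "abs_cont_on S (\<lambda>x. L (f x))"
proof -
  obtain C where C: "C \<ge> 0" "\<And>x. norm (L x) \<le> C * norm x"
    using bounded_linear.nonneg_bounded[OF assms(1)] by (auto simp: mult.commute)
  show ?thesis
  proof (rule abs_cont_on_dominated[OF assms(2) assms(2) C(1)])
    fix x y
    show "norm (L (f y) - L (f x)) \<le> C * (norm (f y - f x) + norm (f y - f x))"
      using C(2)[of "f y - f x"] mult_nonneg_nonneg[OF C(1) norm_ge_zero[of "f y - f x"]]
      by (simp add: linear_diff[OF bounded_linear.linear[OF assms(1)], symmetric] distrib_left)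
  qed
qed

lemma abs_cont_on_add:
  assumes "abs_cont_on S f" "abs_cont_on S g"
  shows "abs_cont_on S (\<lambda>x. f x + g x)"
  by (rule abs_cont_on_dominated[OF assms, of 1])
    (auto intro: order_trans[OF _ norm_triangle_ineq] simp: algebra_simps)

text \<open>The increment of a product splits into one term for each factor's increment. The other
  factor is bounded, because it is continuous on a compact interval.\<close>

lemma abs_cont_on_bilinear:
  assumes "bounded_bilinear B" "abs_cont_on {a..b} f" "abs_cont_on {a..b} g"
  shows "abs_cont_on {a..b} (\<lambda>x. B (f x) (g x))"
proof -
  interpret bounded_bilinear B by fact
  obtain C where C: "C \<ge> 0" "\<And>x y. norm (B x y) \<le> norm x * norm y * C"
    using nonneg_bounded by auto
  have "bounded (f ` {a..b})" "bounded (g ` {a..b})"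
    using assms by (auto intro!: compact_imp_bounded compact_continuous_image abs_cont_on_imp_continuous_on)
  then obtain F G where F: "\<And>x. x \<in> {a..b} \<Longrightarrow> norm (f x) \<le> F" "F > 0" 
     and G: "\<And>x. x \<in> {a..b} \<Longrightarrow> norm (g x) \<le> G" "G > 0"
    unfolding bounded_pos by blast
  show ?thesis
  proof (rule abs_cont_on_dominated[OF assms(2,3)])
    show "(F + G) * C \<ge> 0" using F G C by simp
    fix x y assume xy: "x \<in> {a..b}" "y \<in> {a..b}"
    have "B (f y) (g y) - B (f x) (g x) = B (f y - f x) (g y) + B (f x) (g y - g x)"
      by (simp add: diff_left diff_right)
    also have "norm \<dots> \<le> norm (f y - f x) * norm (g y) * C + norm (f x) * norm (g y - g x) * C"
      by (rule order_trans[OF norm_triangle_ineq]) (intro add_mono C)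
    also have "\<dots> \<le> norm (f y - f x) * (F + G) * C + (F + G) * norm (g y - g x) * C"
      using F(1)[OF xy(1)] G(1)[OF xy(2)] F(2) G(2) C(1)
      by (intro add_mono mult_right_mono mult_left_mono) auto
    finally show "norm (B (f y) (g y) - B (f x) (g x))
        \<le> (F + G) * C * (norm (f y - f x) + norm (g y - g x))"
      by (simp add: algebra_simps)
  qed
qed

section \<open>Calculus of locally absolutely continuous functions with a named almost everywhere
  derivative\<close>

definition ac_deriv :: "(real \<Rightarrow> 'a::real_normed_vector) \<Rightarrow> (real \<Rightarrow> 'a) \<Rightarrow> bool" where
  "ac_deriv f f' \<longleftrightarrow> loc_abs_cont_on UNIV f \<and> (AE x in lebesgue. (f has_vector_derivative f' x) (at x))"

lemma ac_deriv_linear: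
  assumes "bounded_linear L" "ac_deriv f f'"
  shows "ac_deriv (\<lambda>x. L (f x)) (\<lambda>x. L (f' x))"
  using assms unfolding ac_deriv_def loc_abs_cont_on_def
  by (auto intro: abs_cont_on_linear elim!: eventually_mono bounded_linear.has_vector_derivative)

lemma ac_deriv_add:
  assumes "ac_deriv f f'" "ac_deriv g g'"
  shows "ac_deriv (\<lambda>x. f x + g x) (\<lambda>x. f' x + g' x)"
proof -
  have "AE x in lebesgue. ((\<lambda>x. f x + g x) has_vector_derivative f' x + g' x) (at x)"
    using conjunct2[OF assms(1)[unfolded ac_deriv_def]] conjunct2[OF assms(2)[unfolded ac_deriv_def]]
    by eventually_elim (rule has_vector_derivative_add)
  then show ?thesis
    using assms unfolding ac_deriv_def loc_abs_cont_on_def by (auto intro: abs_cont_on_add)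
qed

lemma ac_deriv_bilinear:
  assumes "bounded_bilinear B" "ac_deriv f f'" "ac_deriv g g'"
  shows "ac_deriv (\<lambda>x. B (f x) (g x)) (\<lambda>x. B (f x) (g' x) + B (f' x) (g x))"
proof -
  have "AE x in lebesgue. ((\<lambda>x. B (f x) (g x)) has_vector_derivative B (f x) (g' x) + B (f' x) (g x)) (at x)"
    using conjunct2[OF assms(2)[unfolded ac_deriv_def]] conjunct2[OF assms(3)[unfolded ac_deriv_def]]
    by eventually_elim (rule bounded_bilinear.has_vector_derivative[OF assms(1)])
  then show ?thesis
    using assms unfolding ac_deriv_def loc_abs_cont_on_def by (auto intro: abs_cont_on_bilinear)
qed

text \<open>Lets derivatives be rewritten by identities valid only almost everywhere, such as those
  that use that \<open>\<phi> x\<close> is Hermitian.\<close>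

lemma ac_deriv_cong:
  assumes "ac_deriv f f'" "AE x in lebesgue. f' x = g' x"
  shows "ac_deriv f g'"
proof -
  have "AE x in lebesgue. (f has_vector_derivative g' x) (at x)"
    using conjunct2[OF assms(1)[unfolded ac_deriv_def]] assms(2) by eventually_elim simp
  then show ?thesis using assms(1) by (simp add: ac_deriv_def)
qed

lemma loc_abs_cont_on_UNIV_continuous_on:
  assumes "loc_abs_cont_on UNIV f"
  shows "continuous_on UNIV f"
proof -
  have "isCont f x" for x
  proof -
    have "continuous_on {x-1..x+1} f"
      using assms by (intro abs_cont_on_imp_continuous_on) (auto simp: loc_abs_cont_on_def)
    then show ?thesis by (rule continuous_on_interior) simp
  qed
  then show ?thesis by (simp add: continuous_at_imp_continuous_on)
qed

lemma ac_deriv_continuous_on: "ac_deriv f f' \<Longrightarrow> continuous_on UNIV f"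
  by (simp add: ac_deriv_def loc_abs_cont_on_UNIV_continuous_on)

lemma ac_deriv_has_integral:
  fixes f :: "real \<Rightarrow> 'a::banach"
  assumes "ac_deriv f f'" "a \<le> b"
  shows "(f' has_integral (f b - f a)) {a..b}"
proof -
  obtain N where N: "negligible N" "{x. \<not> (f has_vector_derivative f' x) (at x)} \<subseteq> N"
    using assms(1) unfolding ac_deriv_def eventually_ae_filter_negligible by blast
  have "abs_cont_on {a..b} f"
    using assms(1) by (auto simp: ac_deriv_def loc_abs_cont_on_def)
  from has_integral_abs_cont_on[OF this assms(2) N(1), of f'] N(2)
  show ?thesis by (auto intro: has_vector_derivative_at_within)
qed

text \<open>Mean value inequality for an almost everywhere bound. Both integrands are set to 0 on
  the exceptional null set, so that the bound holds at every point and the integrals are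
  unchanged.\<close>

lemma ac_deriv_norm_diff_le:
  fixes f :: "real \<Rightarrow> 'a::banach"
  assumes f: "ac_deriv f f'" and "a \<le> b" and g: "g integrable_on {a..b}"
    and le: "AE x in lebesgue. x \<in> {a..b} \<longrightarrow> norm (f' x) \<le> g x"
  shows "norm (f b - f a) \<le> integral {a..b} g"
proof -
  obtain N where N: "negligible N" "{x. \<not> (x \<in> {a..b} \<longrightarrow> norm (f' x) \<le> g x)} \<subseteq> N"
    using le unfolding eventually_ae_filter_negligible by blast
  define F where "F x = (if x \<in> N then 0 else f' x)" for x
  define G where "G x = (if x \<in> N then 0 else g x)" for x
  have F: "(F has_integral (f b - f a)) {a..b}"
    by (rule has_integral_spike[OF N(1) _ ac_deriv_has_integral[OF f \<open>a \<le> b\<close>]]) (simp add: F_def)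
  have G: "(G has_integral integral {a..b} g) {a..b}"
    by (rule has_integral_spike[OF N(1) _ integrable_integral[OF g]]) (simp add: G_def)
  have "norm (integral {a..b} F) \<le> integral {a..b} G"
    using F G N(2)
    by (intro integral_norm_bound_integral) (auto simp: has_integral_iff F_def G_def)
  then show ?thesis using F G by (simp add: has_integral_iff)
qed

text \<open>A local substitute for Gronwall's inequality. On a short interval around
  \<open>t\<close> the integral of \<open>k\<close> from \<open>t\<close> is below 1/2, so the
  maximum of \<open>norm (f x)\<close>, attained at \<open>y\<close>, is at most half of
  itself.\<close>

lemma ac_deriv_eq_0_near:
  fixes f :: "real \<Rightarrow> 'a::banach"
  assumes f: "ac_deriv f f'" and k: "\<And>a b. k integrable_on {a..b}" and nonneg: "\<And>x. k x \<ge> 0"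
    and le: "AE x in lebesgue. norm (f' x) \<le> k x * norm (f x)"
    and "f t = 0"
  shows "\<exists>d>0. \<forall>y. dist y t < d \<longrightarrow> f y = 0"
proof -
  define K where "K x = integral {t-1..x} k" for x
  have "continuous_on {t-1..t+1} K"
    unfolding K_def[abs_def] by (rule indefinite_integral_continuous_1[OF k])
  then have "isCont K t" by (rule continuous_on_interior) simp
  then obtain d0 where "d0 > 0" and d0: "\<And>y. dist y t < d0 \<Longrightarrow> dist (K y) (K t) < 1/2"
    unfolding continuous_at_eps_delta by (metis half_gt_zero zero_less_one)
  \<comment> \<open>Strictly below \<open>d0\<close>, so the closed interval lies in the continuity
    ball, and below 1, so it lies to the right of the base point \<open>t - 1\<close> of
    \<open>K\<close>.\<close>
  define d where "d = min d0 1 / 2"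
  have d: "d > 0" "d < d0" "d < 1" using \<open>d0 > 0\<close> by (auto simp: d_def)
  have "continuous_on {t-d..t+d} (\<lambda>x. norm (f x))"
    using ac_deriv_continuous_on[OF f] by (intro continuous_on_norm) (auto intro: continuous_on_subset)
  then obtain y where y: "y \<in> {t-d..t+d}" and ymax: "\<And>x. x \<in> {t-d..t+d} \<Longrightarrow> norm (f x) \<le> norm (f y)"
    using continuous_attains_sup[of "{t-d..t+d}" "\<lambda>x. norm (f x)"] d(1) by auto
  have Kdiff: "integral {a..b} k = K b - K a" if "t - 1 \<le> a" "a \<le> b" for a b
    unfolding K_def using Henstock_Kurzweil_Integration.integral_combine[OF that k] by (simp add: algebra_simps)
  have bound: "norm (f b - f a) \<le> norm (f y) * (K b - K a)" if ab: "a \<le> b" "a \<in> {t-d..t+d}" "b \<in> {t-d..t+d}" for a b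
  proof -
    have "AE x in lebesgue. x \<in> {a..b} \<longrightarrow> norm (f' x) \<le> norm (f y) * k x"
      using le
    proof eventually_elim
      case (elim x)
      show ?case
      proof
        assume "x \<in> {a..b}"
        then have "norm (f x) \<le> norm (f y)" using ab by (intro ymax) auto
        then have "k x * norm (f x) \<le> k x * norm (f y)" using nonneg by (intro mult_left_mono) auto
        with elim show "norm (f' x) \<le> norm (f y) * k x" by (simp add: mult.commute)
      qed
    qed
    then have "norm (f b - f a) \<le> integral {a..b} (\<lambda>x. norm (f y) * k x)"
      by (intro ac_deriv_norm_diff_le[OF f ab(1)] integrable_on_mult_right k)
    also have "\<dots> = norm (f y) * (K b - K a)"
      using Kdiff[of a b] ab d by simp
    finally show ?thesis .
  qed
  have "\<bar>K y - K t\<bar> < 1/2" using d0[of y] y d by (auto simp: dist_real_def)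
  then have "norm (f y) * \<bar>K y - K t\<bar> \<le> norm (f y) * (1/2)" by (intro mult_left_mono) auto
  moreover have "norm (f y) \<le> norm (f y) * \<bar>K y - K t\<bar>"
  proof (cases "t \<le> y")
    case True
    have "norm (f y) \<le> norm (f y) * (K y - K t)"
      using bound[OF True] y d \<open>f t = 0\<close> by simp
    also have "\<dots> \<le> norm (f y) * \<bar>K y - K t\<bar>" by (intro mult_left_mono) auto
    finally show ?thesis .
  next
    case False
    have "norm (f y) \<le> norm (f y) * (K t - K y)"
      using bound[of y t] False y d \<open>f t = 0\<close> by simp
    also have "\<dots> \<le> norm (f y) * \<bar>K y - K t\<bar>" by (intro mult_left_mono) auto
    finally show ?thesis .
  qed
  ultimately have "norm (f y) = 0" using norm_ge_zero[of "f y"] by linarith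
  then have "f x = 0" if "dist x t < d" for x
    using ymax[of x] that by (auto simp: dist_real_def abs_less_iff)
  then show ?thesis using d(1) by blast
qed

text \<open>The zero set of \<open>f\<close> is closed by continuity, open by the local result, and
  nonempty; the line is connected.\<close>

lemma ac_deriv_eq_0:
  fixes f :: "real \<Rightarrow> 'a::banach"
  assumes f: "ac_deriv f f'" and k: "\<And>a b. k integrable_on {a..b}" and nonneg: "\<And>x. k x \<ge> 0"
    and le: "AE x in lebesgue. norm (f' x) \<le> k x * norm (f x)"
    and "f t = 0"
  shows "f x = 0"
proof -
  have "closed {x. f x = 0}"
    using ac_deriv_continuous_on[OF f] by (intro closed_Collect_eq) auto
  moreover have "open {x. f x = 0}"
    unfolding open_dist using ac_deriv_eq_0_near[OF f k nonneg le] by simp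
  ultimately have "{x. f x = 0} = UNIV"
    using \<open>f t = 0\<close> connected_clopen[of "UNIV::real set"] by auto
  then show ?thesis by auto
qed

subsection \<open>Integral estimates on a half-line\<close>

text \<open>Meant for continuous \<open>f\<close>: where \<open>f\<close> is not integrable, the integral is \<open>0\<close> by convention.\<close>

definition half_integral_bounded :: "line_end \<Rightarrow> real \<Rightarrow> (real \<Rightarrow> real) \<Rightarrow> bool" where
  "half_integral_bounded s x0 f \<longleftrightarrow> (\<exists>B. \<forall>a b. {a..b} \<subseteq> half_line s x0 \<longrightarrow> integral {a..b} f \<le> B)"

lemma half_integral_boundedI:
  assumes cont: "continuous_on UNIV f" and nonneg: "\<And>x. f x \<ge> 0"
    and int: "f absolutely_integrable_on half_line s x0"
  shows "half_integral_bounded s x0 f"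
  unfolding half_integral_bounded_def
proof (intro exI allI impI)
  fix a b :: real assume "{a..b} \<subseteq> half_line s x0"
  then show "integral {a..b} f \<le> integral (half_line s x0) f"
    using int nonneg
    by (intro integral_subset_le integrable_continuous_real continuous_on_subset[OF cont])
       (auto simp: absolutely_integrable_on_def)
qed

text \<open>Monotone convergence along the truncations of \<open>f\<close> to the intervals from
  \<open>-n\<close> to \<open>n\<close>.\<close>

lemma absolutely_integrable_half_line:
  assumes cont: "continuous_on UNIV f" and nonneg: "\<And>x. f x \<ge> 0"
    and bdd: "half_integral_bounded s x0 f"
  shows "f absolutely_integrable_on half_line s x0"
proof (rule nonnegative_absolutely_integrable_1)
  let ?I = "half_line s x0"
  obtain B where B: "\<And>a b. {a..b} \<subseteq> ?I \<Longrightarrow> integral {a..b} f \<le> B"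
    using bdd unfolding half_integral_bounded_def by auto
  define g where "g n x = (if x \<in> {-real n..real n} then f x else 0)" for n x
  \<comment> \<open>For small \<open>n\<close> the intersection may be empty; it is then still
    written as an interval with \<open>a > b\<close>.\<close>
  have I: "\<exists>a b. {-real n..real n} \<inter> ?I = {a..b}" for n
    by (cases s) (auto intro: exI[of _ "max (- real n) x0"] exI[of _ "real n"]
        exI[of _ "- real n"] exI[of _ "min (real n) x0"])
  have g_int: "g n integrable_on ?I" and g_le: "integral ?I (g n) \<le> B" and g_ge: "integral ?I (g n) \<ge> 0" for n
  proof -
    obtain a b where ab: "{-real n..real n} \<inter> ?I = {a..b}" using I by blast
    have "f integrable_on {a..b}"
      by (intro integrable_continuous_real continuous_on_subset[OF cont]) auto
    then have "(f has_integral integral {a..b} f) {a..b}" by (rule integrable_integral)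
    then have "(g n has_integral integral {a..b} f) ?I"
      unfolding g_def[abs_def] ab[symmetric] by (subst has_integral_restrict_Int) simp
    then show "g n integrable_on ?I" "integral ?I (g n) \<le> B" "integral ?I (g n) \<ge> 0"
      using B[of a b] ab nonneg \<open>f integrable_on {a..b}\<close>
      by (auto simp: has_integral_iff intro!: integral_nonneg)
  qed
  have "f integrable_on ?I \<and> (\<lambda>k. integral ?I (g k)) \<longlonglongrightarrow> integral ?I f"
  proof (rule monotone_convergence_increasing[OF g_int])
    show "g k x \<le> g (Suc k) x" for k x using nonneg by (auto simp: g_def)
    show "(\<lambda>k. g k x) \<longlonglongrightarrow> f x" for x
    proof -
      obtain N where N: "\<bar>x\<bar> \<le> real N" using real_arch_simple by blast
      have "\<forall>\<^sub>F k in sequentially. g k x = f x"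
        using eventually_ge_at_top[of N] by eventually_elim (use N in \<open>auto simp: g_def\<close>)
      then show ?thesis by (rule tendsto_eventually)
    qed
    show "bounded (range (\<lambda>k. integral ?I (g k)))"
      using g_le g_ge by (intro boundedI[of _ B]) auto
  qed
  then show "f integrable_on ?I" by simp
qed (use nonneg in auto)

lemma continuous_on_reflect:
  fixes f :: "real \<Rightarrow> 'a::topological_space"
  assumes "continuous_on UNIV f"
  shows "continuous_on UNIV (\<lambda>x. f (- x))"
  by (rule continuous_on_compose2[OF assms]) (auto intro: continuous_intros)

text \<open>Transfers the estimates, proved only towards plus infinity, to the other end of the
  line.\<close>

lemma half_integral_bounded_reflect:
  "half_integral_bounded MinusInf x0 f \<longleftrightarrow> half_integral_bounded PlusInf (-x0) (\<lambda>x. f (-x))"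
proof -
  have "(\<forall>a b. {a..b} \<subseteq> {..x0} \<longrightarrow> integral {a..b} f \<le> B)
    \<longleftrightarrow> (\<forall>a b. {a..b} \<subseteq> {-x0..} \<longrightarrow> integral {a..b} (\<lambda>x. f (-x)) \<le> B)" (is "?l \<longleftrightarrow> ?r") for B
  proof
    assume l: ?l
    show ?r
    proof (intro allI impI)
      fix a b :: real assume sub: "{a..b} \<subseteq> {-x0..}"
      have "t \<in> {..x0}" if "t \<in> {-b..-a}" for t using subsetD[OF sub, of "-t"] that by auto
      then have "{-b..-a} \<subseteq> {..x0}" by blast
      with l have "integral {-b..-a} f \<le> B" by blast
      then show "integral {a..b} (\<lambda>x. f (-x)) \<le> B" using Henstock_Kurzweil_Integration.integral_reflect_real[of "-a" "-b" f] by simp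
    qed
  next
    assume r: ?r
    show ?l
    proof (intro allI impI)
      fix a b :: real assume sub: "{a..b} \<subseteq> {..x0}"
      have "t \<in> {-x0..}" if "t \<in> {-b..-a}" for t using subsetD[OF sub, of "-t"] that by auto
      then have "{-b..-a} \<subseteq> {-x0..}" by blast
      with r have "integral {-b..-a} (\<lambda>x. f (-x)) \<le> B" by blast
      then show "integral {a..b} f \<le> B" by simp
    qed
  qed
  then show ?thesis unfolding half_integral_bounded_def by simp
qed

text \<open>Since \<open>q\<close> has derivative \<open>c * w \<ge> 0\<close>, it is nondecreasing.
  If \<open>w x0\<close> were positive, then \<open>q\<close> would be positive at
  \<open>x0 + 1\<close>, and \<open>w\<close>, which dominates \<open>q\<close>, would stay above
  this constant, contradicting the bound on its integrals.\<close>

lemma half_line_energy_zero_aux: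
  fixes w q :: "real \<Rightarrow> real"
  assumes cont: "continuous_on UNIV w" and nonneg: "\<And>x. w x \<ge> 0"
    and bdd: "half_integral_bounded PlusInf x0 w" and "c > 0"
    and q: "\<And>a b. a \<le> b \<Longrightarrow> ((\<lambda>x. c * w x) has_integral q b - q a) {a..b}"
    and le: "\<And>x. q x \<le> w x" and "q x0 = 0"
  shows "w x0 = 0"
proof (rule ccontr)
  assume "w x0 \<noteq> 0"
  have int: "w integrable_on {a..b}" for a b
    by (intro integrable_continuous_real continuous_on_subset[OF cont]) auto
  have q_eq: "q b - q a = c * integral {a..b} w" if "a \<le> b" for a b
    using q[OF that] by (auto simp: has_integral_iff)
  have "integral {x0..x0+1} w \<ge> 0"
    by (intro integral_nonneg int nonneg)
  moreover have "integral {x0..x0+1} w \<noteq> 0"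
    using \<open>w x0 \<noteq> 0\<close> nonneg
    by (subst integral_eq_0_iff) (auto intro: continuous_on_subset[OF cont])
  ultimately have pos: "q (x0 + 1) > 0"
    using q_eq[of x0 "x0+1"] \<open>q x0 = 0\<close> \<open>c > 0\<close> by simp
  obtain B where B: "\<And>a b. {a..b} \<subseteq> {x0..} \<Longrightarrow> integral {a..b} w \<le> B"
    using bdd unfolding half_integral_bounded_def by auto
  have "t * q (x0 + 1) \<le> B" if "t \<ge> 0" for t
  proof -
    have "w x \<ge> q (x0 + 1)" if "x \<in> {x0 + 1..x0 + 1 + t}" for x
    proof -
      have "c * integral {x0+1..x} w \<ge> 0"
        using \<open>c > 0\<close> nonneg by (intro mult_nonneg_nonneg integral_nonneg int) auto
      then show ?thesis using q_eq[of "x0+1" x] that le[of x] by auto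
    qed
    then have "integral {x0 + 1..x0 + 1 + t} (\<lambda>x. q (x0 + 1)) \<le> integral {x0 + 1..x0 + 1 + t} w"
      by (intro integral_le int) auto
    also have "\<dots> \<le> B" by (rule B) auto
    finally show ?thesis using that by simp
  qed
  \<comment> \<open>For this length the lower bound for the integral equals
    \<open>\<bar>B\<bar> + 1\<close>, which exceeds \<open>B\<close>.\<close>
  from this[of "(\<bar>B\<bar> + 1) / q (x0 + 1)"] show False using pos by simp
qed

text \<open>Two normalizations reduce this to the previous lemma: the factor \<open>sgn c\<close>
  makes the constant positive, and reflection handles the left half-line.\<close>

lemma half_line_energy_zero:
  fixes w q :: "real \<Rightarrow> real"
  assumes cont: "continuous_on UNIV w" and nonneg: "\<And>x. w x \<ge> 0"
    and bdd: "half_integral_bounded s x0 w" and "c \<noteq> 0"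
    and q: "\<And>a b. a \<le> b \<Longrightarrow> ((\<lambda>x. c * w x) has_integral q b - q a) {a..b}"
    and le: "\<And>x. \<bar>q x\<bar> \<le> w x" and "q x0 = 0"
  shows "w x0 = 0"
proof -
  define q1 where "q1 x = sgn c * q x" for x
  have eq: "sgn c * (c * y) = \<bar>c\<bar> * y" for y
    by (cases "c < 0") (use \<open>c \<noteq> 0\<close> in auto)
  have q1: "((\<lambda>x. \<bar>c\<bar> * w x) has_integral q1 b - q1 a) {a..b}" if "a \<le> b" for a b
    using has_integral_mult_right[OF q[OF that], of "sgn c"]
    by (simp add: q1_def right_diff_distrib eq)
  have le1: "\<bar>q1 x\<bar> \<le> w x" for x
    using le[of x] \<open>c \<noteq> 0\<close> by (simp add: q1_def abs_mult abs_sgn_eq)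
  show ?thesis
  proof (cases s)
    case PlusInf
    show ?thesis
      by (rule half_line_energy_zero_aux[OF cont nonneg _ _ q1])
        (use bdd \<open>c \<noteq> 0\<close> le1 \<open>q x0 = 0\<close> PlusInf in \<open>auto simp: q1_def abs_le_iff\<close>)
  next
    case MinusInf
    \<comment> \<open>Reflection reverses the sign of a derivative; the outer minus sign restores
      it.\<close>
    define q2 where "q2 x = - q1 (- x)" for x
    have q2: "((\<lambda>x. \<bar>c\<bar> * w (-x)) has_integral q2 b - q2 a) {a..b}" if "a \<le> b" for a b
      using q1[of "-b" "-a"] that has_integral_reflect_real[where f = "\<lambda>x. \<bar>c\<bar> * w x" and a = "-b" and b = "-a"]
      by (simp add: q2_def algebra_simps)
    have "w (- (- x0)) = 0"
      by (rule half_line_energy_zero_aux[OF _ _ _ _ q2])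
        (use bdd \<open>c \<noteq> 0\<close> le1 \<open>q x0 = 0\<close> MinusInf nonneg in
          \<open>auto simp: q1_def q2_def abs_le_iff half_integral_bounded_reflect
             intro: continuous_on_reflect[OF cont]\<close>)
    then show ?thesis by simp
  qed
qed

lemma four_mult_le_power2: "4 * (a * b) \<le> (a + b)\<^sup>2" for a b :: real
  using zero_le_power2[of "a - b"] by (simp add: power2_eq_square algebra_simps)

text \<open>Scalar core of the second fact of the overview: \<open>g\<close> and \<open>h\<close>
  stand for the squared norms of a solution and its quasi-derivative, \<open>q\<close> for their
  real inner product, \<open>r\<close> for \<open>Re z\<close>. The last hypothesis is the
  Cauchy-Schwarz inequality.\<close>

lemma half_line_derivative_bounded_aux:
  fixes g h q :: "real \<Rightarrow> real"
  assumes cont: "continuous_on UNIV g" "continuous_on UNIV h"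
    and nonneg: "\<And>x. g x \<ge> 0" "\<And>x. h x \<ge> 0"
    and bdd: "half_integral_bounded PlusInf x0 g"
    and q: "\<And>a b. a \<le> b \<Longrightarrow> ((\<lambda>x. h x - r * g x) has_integral q b - q a) {a..b}"
    and le: "\<And>x. (q x)\<^sup>2 \<le> g x * h x"
  shows "half_integral_bounded PlusInf x0 h"
proof -
  define G where "G x = integral {x0..x} g" for x
  define F where "F x = integral {x0..x} h" for x
  have int: "g integrable_on {a..b}" "h integrable_on {a..b}" for a b
    by (intro integrable_continuous_real continuous_on_subset[OF cont(1)] continuous_on_subset[OF cont(2)]; simp)+
  obtain B0 where B0: "\<And>a b. {a..b} \<subseteq> {x0..} \<Longrightarrow> integral {a..b} g \<le> B0"
    using bdd unfolding half_integral_bounded_def by auto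
  define B where "B = max B0 0"
  have G: "0 \<le> G x" "G x \<le> B" for x
    unfolding G_def B_def using B0[of x0 x] nonneg by (auto intro!: integral_nonneg int)
  have Fmono: "F x \<le> F y" if "x \<le> y" for x y
    unfolding F_def using that nonneg by (intro integral_subset_le int) auto
  have dG: "(G has_real_derivative g x) (at x)" and dF: "(F has_real_derivative h x) (at x)" if "x > x0" for x
  proof -
    have "at x within {x0..x+1} = at x" using that by (intro at_within_interior) auto
    then show "(G has_real_derivative g x) (at x)" "(F has_real_derivative h x) (at x)"
      using integral_has_real_derivative[of x0 "x+1" g x] integral_has_real_derivative[of x0 "x+1" h x] that
        continuous_on_subset[OF cont(1), of "{x0..x+1}"] continuous_on_subset[OF cont(2), of "{x0..x+1}"]
      unfolding G_def[abs_def] F_def[abs_def] by auto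
  qed
  have q_eq: "q x = q x0 + F x - r * G x" if "x \<ge> x0" for x
  proof -
    have "((\<lambda>x. h x - r * g x) has_integral F x - r * G x) {x0..x}"
      unfolding F_def G_def
      by (intro has_integral_diff has_integral_mult_right integrable_integral int)
    with q[OF that] have "q x - q x0 = F x - r * G x" by (rule has_integral_unique)
    then show ?thesis by simp
  qed
  \<comment> \<open>Once \<open>F x > L\<close>, the terms other than \<open>F x\<close> in
    \<open>q_eq\<close> amount to less than \<open>F x / 2\<close>, so
    \<open>q x \<ge> F x / 2\<close>. The summand 1 keeps \<open>F\<close> away from 0.\<close>
  define L where "L = 2 * (\<bar>q x0\<bar> + \<bar>r\<bar> * B) + 1"
  have "\<exists>C. \<forall>x\<ge>x0. F x \<le> C"
  proof (rule ccontr)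
    assume "\<not> ?thesis"
    then obtain X where X: "X \<ge> x0" "F X > L" by (meson not_le)
    have "L \<ge> 1" using G[of x0] by (simp add: L_def)
    have "F x0 = 0" by (simp add: F_def)
    with X \<open>L \<ge> 1\<close> have "X > x0" by (cases "X = x0") auto
    define R where "R x = x - G x + 1 / F x" for x
    have FL: "F x > L" if "x \<ge> X" for x using X Fmono[OF that] by simp
    have "\<exists>y. (R has_real_derivative y) (at x) \<and> y \<le> 0" if "x \<ge> X" for x
    proof (intro exI conjI)
      have "x > x0" using that \<open>X > x0\<close> by simp
      have Fpos: "F x > 0" using FL[OF that] \<open>L \<ge> 1\<close> by simp
      show "(R has_real_derivative (1 - g x + - h x / (F x)\<^sup>2)) (at x)"
        unfolding R_def[abs_def] using Fpos
        by (auto intro!: derivative_eq_intros dG[OF \<open>x > x0\<close>] dF[OF \<open>x > x0\<close>] simp: power2_eq_square)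
      have "\<bar>r * G x\<bar> \<le> \<bar>r\<bar> * B" using G[of x] by (simp add: abs_mult mult_left_mono)
      then have "q x \<ge> F x / 2" using q_eq[of x] \<open>x > x0\<close> FL[OF that] unfolding L_def by (simp add: abs_le_iff) linarith
      then have "(F x / 2)\<^sup>2 \<le> (q x)\<^sup>2" using Fpos by (intro power_mono) auto
      also note le[of x]
      \<comment> \<open>So \<open>g x\<close> and \<open>h x / (F x)\<^sup>2\<close> have product at
        least 1/4, hence sum at least 1 by the arithmetic-geometric mean inequality. This is exactly
        what makes the derivative of \<open>R\<close> nonpositive.\<close>
      finally have "(F x)\<^sup>2 \<le> 4 * (g x * h x)" by (simp add: power_divide)
      then have "1 \<le> 4 * (g x * (h x / (F x)\<^sup>2))" using Fpos by (simp add: field_simps)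
      also have "\<dots> \<le> (g x + h x / (F x)\<^sup>2)\<^sup>2"
        by (rule four_mult_le_power2)
      finally have "1\<^sup>2 \<le> (g x + h x / (F x)\<^sup>2)\<^sup>2" by simp
      then have "1 \<le> g x + h x / (F x)\<^sup>2"
        by (rule power2_le_imp_le) (use nonneg in auto)
      then show "1 - g x + - h x / (F x)\<^sup>2 \<le> 0" by simp
    qed
    then have R: "R Y \<le> R X" if "Y \<ge> X" for Y
      by (intro DERIV_nonpos_imp_nonincreasing[OF that]) auto
    \<comment> \<open>Far enough out that \<open>R Y \<ge> Y - B \<ge> R X + 1\<close>, against
      monotonicity.\<close>
    define Y where "Y = max X (R X + B + 1)"
    have "F Y > 0" using FL[of Y] \<open>L \<ge> 1\<close> by (simp add: Y_def)
    then have "Y - B \<le> R Y" using G[of Y] by (simp add: R_def add_increasing2 diff_left_mono add_increasing)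
    with R[of Y] show False by (simp add: Y_def split: if_splits)
  qed
  then obtain C where C: "\<And>x. x \<ge> x0 \<Longrightarrow> F x \<le> C" by blast
  \<comment> \<open>The 0 covers empty intervals, which lie in every half-line.\<close>
  have "integral {a..b} h \<le> max C 0" if "{a..b} \<subseteq> half_line PlusInf x0" for a b
  proof (cases "a \<le> b")
    case True
    then have "x0 \<le> a" using that by auto
    have "integral {a..b} h \<le> F b"
      unfolding F_def using \<open>x0 \<le> a\<close> nonneg by (intro integral_subset_le int) auto
    also have "\<dots> \<le> C" using C True \<open>x0 \<le> a\<close> by simp
    finally show ?thesis by simp
  qed simp
  then show ?thesis unfolding half_integral_bounded_def by blast
qed

lemma half_line_derivative_bounded:
  fixes g h q :: "real \<Rightarrow> real"
  assumes cont: "continuous_on UNIV g" "continuous_on UNIV h"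
    and nonneg: "\<And>x. g x \<ge> 0" "\<And>x. h x \<ge> 0"
    and bdd: "half_integral_bounded s x0 g"
    and q: "\<And>a b. a \<le> b \<Longrightarrow> ((\<lambda>x. h x - r * g x) has_integral q b - q a) {a..b}"
    and le: "\<And>x. (q x)\<^sup>2 \<le> g x * h x"
  shows "half_integral_bounded s x0 h"
proof (cases s)
  case PlusInf
  then show ?thesis using half_line_derivative_bounded_aux[OF cont nonneg _ q le] bdd by simp
next
  case MinusInf
  define q2 where "q2 x = - q (- x)" for x
  have q2: "((\<lambda>x. h (-x) - r * g (-x)) has_integral q2 b - q2 a) {a..b}" if "a \<le> b" for a b
    using q[of "-b" "-a"] that has_integral_reflect_real[where f = "\<lambda>x. h x - r * g x" and a = "-b" and b = "-a"]
    by (simp add: q2_def algebra_simps)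
  have "half_integral_bounded PlusInf (-x0) (\<lambda>x. h (-x))"
    by (rule half_line_derivative_bounded_aux[OF _ _ nonneg _ q2])
      (use bdd MinusInf le in \<open>auto simp: q2_def half_integral_bounded_reflect
        intro: continuous_on_reflect[OF cont(1)] continuous_on_reflect[OF cont(2)]\<close>)
  then show ?thesis by (simp add: MinusInf half_integral_bounded_reflect)
qed

subsection \<open>The first-order system\<close>

lemma norm_smult_vec: "norm (a *s v) = norm a * norm v" for a :: complex and v :: "complex^'n"
  by (simp add: norm_vec_def norm_mult L2_set_right_distrib)

lemma bounded_linear_smult_vec: "bounded_linear (\<lambda>v :: complex^'n. a *s v)"
  by (rule bounded_linear_intro[of _ "norm a"])
     (auto simp: vec_eq_iff norm_smult_vec algebra_simps)

lemma bounded_bilinear_matrix_vector_mult: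
  "bounded_bilinear ((*v) :: complex^'n^'m \<Rightarrow> complex^'n \<Rightarrow> complex^'m)"
  unfolding bilinear_conv_bounded_bilinear[symmetric] bilinear_def
  by (auto intro!: linearI simp: matrix_vector_right_distrib matrix_vector_mult_add_rdistrib
      matrix_vector_mult_def vec_eq_iff scaleR_sum_right sum.distrib algebra_simps)

lemma inner_complex_eq_Re: "inner x y = Re (x * cnj y)"
  by (simp add: inner_complex_def)

lemma inner_complex_vec: "inner u v = Re (\<Sum>i\<in>UNIV. u $ i * cnj (v $ i))" for u v :: "complex^'n"
  by (simp add: inner_vec_def inner_complex_eq_Re)

text \<open>The library's \<open>inner\<close> is the real part of the Hermitian product. Factors
  such as \<i> or \<zeta> therefore select real or imaginary parts of the spectral parameter in the
  energy identities.\<close>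

lemma inner_smult_smult_self:
  "inner (a *s u) (b *s u) = Re (a * cnj b) * (norm u)\<^sup>2" for u :: "complex^'n"
proof -
  have "inner (a * w) (b * w) = Re (a * cnj b) * (norm w)\<^sup>2" for w
    unfolding cmod_power2 by (simp add: inner_complex_def algebra_simps power2_eq_square)
  then have "inner (a *s u) (b *s u) = (\<Sum>i\<in>UNIV. Re (a * cnj b) * (norm (u $ i))\<^sup>2)"
    by (simp add: inner_vec_def)
  also have "\<dots> = Re (a * cnj b) * (norm u)\<^sup>2"
    by (simp add: norm_vec_def L2_set_def sum_nonneg sum_distrib_left)
  finally show ?thesis .
qed

text \<open>Self-adjointness of the potential is what cancels the \<open>\<phi>\<close> terms in the
  derivatives of the two quadratic forms below.\<close>

lemma hermitian_inner:
  fixes A :: "complex^'n^'n"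
  assumes "hermitian A"
  shows "inner (A *v u) v = inner u (A *v v)"
proof -
  have A: "cnj (A $ j $ i) = A $ i $ j" for i j
    using assms unfolding hermitian_def transpose_def vec_eq_iff by simp
  have "(\<Sum>i\<in>UNIV. (A *v u) $ i * cnj (v $ i)) = (\<Sum>i\<in>UNIV. \<Sum>j\<in>UNIV. A $ i $ j * u $ j * cnj (v $ i))"
    by (simp add: matrix_vector_mult_def sum_distrib_right)
  also have "\<dots> = (\<Sum>j\<in>UNIV. \<Sum>i\<in>UNIV. A $ i $ j * u $ j * cnj (v $ i))"
    by (rule sum.swap)
  also have "\<dots> = (\<Sum>j\<in>UNIV. u $ j * cnj ((A *v v) $ j))"
    by (simp add: matrix_vector_mult_def sum_distrib_left A mult_ac)
  finally show ?thesis by (simp add: inner_complex_vec)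
qed

section \<open>Algebra of solutions of the first-order system, and uniqueness\<close>

definition first_order_system :: "(real \<Rightarrow> complex^'m^'m) \<Rightarrow> complex \<Rightarrow> complex
    \<Rightarrow> (real \<Rightarrow> complex^'m) \<Rightarrow> (real \<Rightarrow> complex^'m) \<Rightarrow> bool" where
  "first_order_system \<phi> \<alpha> \<beta> f g \<longleftrightarrow>
     ac_deriv f (\<lambda>x. \<alpha> *s g x - \<phi> x *v f x) \<and> ac_deriv g (\<lambda>x. \<phi> x *v g x - \<beta> *s f x)"

lemma first_order_system_continuous_on:
  assumes "first_order_system \<phi> \<alpha> \<beta> f g"
  shows "continuous_on UNIV f" "continuous_on UNIV g"
  using assms unfolding first_order_system_def by (auto intro: ac_deriv_continuous_on)

lemma first_order_system_zero: "first_order_system \<phi> \<alpha> \<beta> (\<lambda>x. 0) (\<lambda>x. 0)"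
proof -
  have "loc_abs_cont_on UNIV (\<lambda>x. 0 :: complex^'m)"
    unfolding loc_abs_cont_on_def abs_cont_on_def by (auto intro: exI[of _ 1])
  then show ?thesis by (simp add: first_order_system_def ac_deriv_def)
qed

lemma first_order_system_add:
  assumes "first_order_system \<phi> \<alpha> \<beta> f g" "first_order_system \<phi> \<alpha> \<beta> f' g'"
  shows "first_order_system \<phi> \<alpha> \<beta> (\<lambda>x. f x + f' x) (\<lambda>x. g x + g' x)"
  unfolding first_order_system_def
proof
  show "ac_deriv (\<lambda>x. f x + f' x) (\<lambda>x. \<alpha> *s (g x + g' x) - \<phi> x *v (f x + f' x))"
    by (rule ac_deriv_cong[OF ac_deriv_add[OF conjunct1[OF assms(1)[unfolded first_order_system_def]]
          conjunct1[OF assms(2)[unfolded first_order_system_def]]]])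
      (simp add: vector_add_ldistrib matrix_vector_right_distrib)
  show "ac_deriv (\<lambda>x. g x + g' x) (\<lambda>x. \<phi> x *v (g x + g' x) - \<beta> *s (f x + f' x))"
    by (rule ac_deriv_cong[OF ac_deriv_add[OF conjunct2[OF assms(1)[unfolded first_order_system_def]]
          conjunct2[OF assms(2)[unfolded first_order_system_def]]]])
      (simp add: vector_add_ldistrib matrix_vector_right_distrib)
qed

text \<open>The conditions say that both equations survive the rescaling. With \<open>a = 1\<close>
  and \<open>b = \<zeta>\<close> they turn the parameters (\<zeta>, \<zeta>) of the Dirac system
  into (1, z), where \<open>z = \<zeta>\<^sup>2\<close>.\<close>

lemma first_order_system_scale:
  fixes \<phi> :: "real \<Rightarrow> complex^'m^'m"
  assumes "first_order_system \<phi> \<alpha> \<beta> f g" and "a * \<alpha> = b * \<alpha>'" "b * \<beta> = a * \<beta>'"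
  shows "first_order_system \<phi> \<alpha>' \<beta>' (\<lambda>x. a *s f x) (\<lambda>x. b *s g x)"
  unfolding first_order_system_def
proof
  have a: "a *s (\<alpha> *s v) = \<alpha>' *s (b *s v)" and b: "b *s (\<beta> *s v) = \<beta>' *s (a *s v)" for v :: "complex^'m"
    using assms(2,3) by (simp_all add: vector_smult_assoc mult.commute)
  show "ac_deriv (\<lambda>x. a *s f x) (\<lambda>x. \<alpha>' *s (b *s g x) - \<phi> x *v (a *s f x))"
    by (rule ac_deriv_cong[OF ac_deriv_linear[OF bounded_linear_smult_vec
            conjunct1[OF assms(1)[unfolded first_order_system_def]]]])
      (rule AE_I2, simp only: a vector_scalar_commute vector_ssub_ldistrib)
  show "ac_deriv (\<lambda>x. b *s g x) (\<lambda>x. \<phi> x *v (b *s g x) - \<beta>' *s (a *s f x))"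
    by (rule ac_deriv_cong[OF ac_deriv_linear[OF bounded_linear_smult_vec
            conjunct2[OF assms(1)[unfolded first_order_system_def]]]])
      (rule AE_I2, simp only: b vector_scalar_commute vector_ssub_ldistrib)
qed

lemma minus_matrix_vector_mult: "(- A) *v v = - (A *v v)" for A :: "complex^'n^'m"
  by (rule bounded_bilinear.minus_left[OF bounded_bilinear_matrix_vector_mult])

text \<open>The exchange also negates the parameters; a rescaling of one component by a negative
  multiple of \<zeta> or its reciprocal compensates for this later.\<close>

lemma first_order_system_swap:
  assumes "first_order_system \<phi> \<alpha> \<beta> f g"
  shows "first_order_system (\<lambda>x. - \<phi> x) (- \<beta>) (- \<alpha>) g f"
proof -
  have 1: "(\<lambda>x. (- \<beta>) *s f x - (- \<phi> x) *v g x) = (\<lambda>x. \<phi> x *v g x - \<beta> *s f x)"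
    and 2: "(\<lambda>x. (- \<phi> x) *v f x - (- \<alpha>) *s g x) = (\<lambda>x. \<alpha> *s g x - \<phi> x *v f x)"
    by (simp_all add: minus_matrix_vector_mult)
  show ?thesis using assms unfolding first_order_system_def 1 2 by simp
qed

lemma first_order_system_sum:
  assumes "finite I" "\<And>i. i \<in> I \<Longrightarrow> first_order_system \<phi> \<alpha> \<beta> (f i) (g i)"
  shows "first_order_system \<phi> \<alpha> \<beta> (\<lambda>x. \<Sum>i\<in>I. c i *s f i x) (\<lambda>x. \<Sum>i\<in>I. c i *s g i x)"
  using assms
proof (induction I rule: finite_induct)
  case (insert i I)
  have "first_order_system \<phi> \<alpha> \<beta> (\<lambda>x. c i *s f i x) (\<lambda>x. c i *s g i x)"
    by (rule first_order_system_scale[of _ \<alpha> \<beta>]) (use insert.prems in auto)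
  from first_order_system_add[OF this insert.IH] insert.hyps insert.prems show ?case by simp
qed (simp add: first_order_system_zero)

text \<open>The pair, as one function into a product space, has a derivative bounded by
  \<open>k x\<close> times its norm. Here \<open>k\<close> is built from the norm of
  \<open>\<phi>\<close> and so is integrable on compact intervals.\<close>

lemma first_order_system_unique:
  fixes \<phi> :: "real \<Rightarrow> complex^'m^'m"
  assumes sys: "first_order_system \<phi> \<alpha> \<beta> f g"
    and phi: "\<And>a b. \<phi> absolutely_integrable_on {a..b}"
    and "f t = 0" "g t = 0"
  shows "f x = 0 \<and> g x = 0"
proof -
  define V where "V x = (f x, g x)" for x
  define V' where "V' x = (\<alpha> *s g x - \<phi> x *v f x, \<phi> x *v g x - \<beta> *s f x)" for x
  have "ac_deriv (\<lambda>x. (f x, 0) + (0, g x)) (\<lambda>x. (\<alpha> *s g x - \<phi> x *v f x, 0) + (0, \<phi> x *v g x - \<beta> *s f x))"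
    using sys unfolding first_order_system_def
    by (intro ac_deriv_add ac_deriv_linear[of "\<lambda>u. (u, 0)"] ac_deriv_linear[of "\<lambda>u. (0, u)"])
       (auto intro: bounded_linear_Pair bounded_linear_ident bounded_linear_zero)
  then have V: "ac_deriv V V'" by (simp add: V_def[abs_def] V'_def[abs_def])
  obtain C where "C \<ge> 0" "\<forall>(A :: complex^'m^'m) v. norm (A *v v) \<le> norm A * norm v * C"
    using bounded_bilinear.nonneg_bounded[OF bounded_bilinear_matrix_vector_mult] by blast
  then have C: "norm (A *v v) \<le> norm A * norm v * C" "C \<ge> 0" for A :: "complex^'m^'m" and v
    by auto
  define k where "k x = norm \<alpha> + norm \<beta> + 2 * C * norm (\<phi> x)" for x
  have k: "k integrable_on {a..b}" for a b
    unfolding k_def[abs_def] using phi[of a b]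
    by (intro integrable_add integrable_const_ivl integrable_on_mult_right)
       (auto simp: absolutely_integrable_on_def)
  have k0: "k x \<ge> 0" for x using C by (simp add: k_def)
  have "norm (V' x) \<le> k x * norm (V x)" for x
  proof -
    have f: "norm (f x) \<le> norm (V x)" and g: "norm (g x) \<le> norm (V x)"
      by (simp_all add: V_def norm_fst_le norm_snd_le)
    have Cv: "norm (\<phi> x *v u) \<le> norm (\<phi> x) * norm (V x) * C" if "norm u \<le> norm (V x)" for u
      using that C(2) by (intro order_trans[OF C(1)] mult_left_mono mult_right_mono) auto
    have "norm (V' x) \<le> norm (\<alpha> *s g x - \<phi> x *v f x) + norm (\<phi> x *v g x - \<beta> *s f x)"
      unfolding V'_def by (rule norm_Pair_le)
    also have "\<dots> \<le> (norm (\<alpha> *s g x) + norm (\<phi> x *v f x)) + (norm (\<phi> x *v g x) + norm (\<beta> *s f x))"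
      by (intro add_mono norm_triangle_ineq4)
    also have "\<dots> \<le> (norm \<alpha> * norm (V x) + norm (\<phi> x) * norm (V x) * C)
        + (norm (\<phi> x) * norm (V x) * C + norm \<beta> * norm (V x))"
      unfolding norm_smult_vec using f g by (intro add_mono mult_left_mono Cv) auto
    also have "\<dots> = k x * norm (V x)" by (simp add: k_def algebra_simps)
    finally show ?thesis .
  qed
  then have le: "AE x in lebesgue. norm (V' x) \<le> k x * norm (V x)" by (rule AE_I2)
  have "V t = 0" using \<open>f t = 0\<close> \<open>g t = 0\<close> by (simp add: V_def zero_prod_def)
  with ac_deriv_eq_0[OF V k k0 le] have "V x = 0" by blast
  then show ?thesis by (simp add: V_def zero_prod_def)
qed

section \<open>Square integrability of continuous functions on a half-line\<close>

lemma continuous_on_norm_power2: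
  "continuous_on S f \<Longrightarrow> continuous_on S (\<lambda>x. (norm (f x))\<^sup>2)"
  by (intro continuous_on_power continuous_on_norm)

abbreviation (input) half_L2 :: "line_end \<Rightarrow> real \<Rightarrow> (real \<Rightarrow> 'a::real_normed_vector) \<Rightarrow> bool" where
  "half_L2 s x0 f \<equiv> half_integral_bounded s x0 (\<lambda>x. (norm (f x))\<^sup>2)"

text \<open>Continuity settles measurability, so square integrability becomes a uniform bound on
  integrals over compact intervals, the form used by all estimates here.\<close>

lemma square_integrable_on_half_line_iff:
  fixes f :: "real \<Rightarrow> 'a::euclidean_space"
  assumes "continuous_on UNIV f"
  shows "square_integrable_on (half_line s x0) f \<longleftrightarrow> half_L2 s x0 f"
proof -
  have cont: "continuous_on UNIV (\<lambda>x. (norm (f x))\<^sup>2)"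
    using assms by (intro continuous_intros)
  have "f \<in> borel_measurable lborel"
    using borel_measurable_continuous_onI[OF assms] by simp
  then have "f \<in> borel_measurable lebesgue" by (rule measurable_completion)
  moreover have "half_line s x0 \<in> sets lebesgue" by (cases s) auto
  ultimately have "set_borel_measurable lebesgue (half_line s x0) f"
    unfolding set_borel_measurable_def by (intro borel_measurable_scaleR borel_measurable_indicator)
  then show ?thesis
    unfolding square_integrable_on_def
    using half_integral_boundedI[OF cont, of s x0] absolutely_integrable_half_line[OF cont, of s x0]
    by auto
qed

lemma half_integral_bounded_dominated:
  assumes cont: "continuous_on UNIV f" "continuous_on UNIV g" "continuous_on UNIV h"
    and bdd: "half_integral_bounded s x0 f" "half_integral_bounded s x0 g" and "C \<ge> 0"
    and le: "\<And>x. h x \<le> C * (f x + g x)"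
  shows "half_integral_bounded s x0 h"
proof -
  have int: "f integrable_on {a..b}" "g integrable_on {a..b}" "h integrable_on {a..b}" for a b
    by (intro integrable_continuous_real continuous_on_subset[OF cont(1)]
        continuous_on_subset[OF cont(2)] continuous_on_subset[OF cont(3)]; simp)+
  obtain B where B: "\<And>a b. {a..b} \<subseteq> half_line s x0 \<Longrightarrow> integral {a..b} f \<le> B"
    using bdd(1) unfolding half_integral_bounded_def by auto
  obtain B' where B': "\<And>a b. {a..b} \<subseteq> half_line s x0 \<Longrightarrow> integral {a..b} g \<le> B'"
    using bdd(2) unfolding half_integral_bounded_def by auto
  have "integral {a..b} h \<le> C * (B + B')" if "{a..b} \<subseteq> half_line s x0" for a b
  proof -
    have "integral {a..b} h \<le> integral {a..b} (\<lambda>x. C * (f x + g x))"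
      by (intro integral_le integrable_on_mult_right integrable_add int le)
    also have "\<dots> = C * (integral {a..b} f + integral {a..b} g)"
      by (simp add: integral_add int)
    also have "\<dots> \<le> C * (B + B')" using B[OF that] B'[OF that] \<open>C \<ge> 0\<close> by (intro mult_left_mono) auto
    finally show ?thesis .
  qed
  then show ?thesis unfolding half_integral_bounded_def by blast
qed

lemma half_L2_add:
  assumes "continuous_on UNIV f" "continuous_on UNIV g" "half_L2 s x0 f" "half_L2 s x0 g"
  shows "half_L2 s x0 (\<lambda>x. f x + g x)"
proof (rule half_integral_bounded_dominated[OF _ _ _ assms(3,4), of _ 2])
  fix x
  have "(norm (f x + g x))\<^sup>2 \<le> (norm (f x) + norm (g x))\<^sup>2"
    by (intro power_mono norm_triangle_ineq) auto
  also have "\<dots> \<le> 2 * ((norm (f x))\<^sup>2 + (norm (g x))\<^sup>2)"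
    using zero_le_power2[of "norm (f x) - norm (g x)"] by (simp add: power2_eq_square algebra_simps)
  finally show "(norm (f x + g x))\<^sup>2 \<le> 2 * ((norm (f x))\<^sup>2 + (norm (g x))\<^sup>2)" .
qed (use assms in \<open>auto intro: continuous_on_norm_power2 continuous_on_add\<close>)

lemma half_L2_linear:
  assumes L: "bounded_linear L" and cont: "continuous_on UNIV f" and f: "half_L2 s x0 f"
  shows "half_L2 s x0 (\<lambda>x. L (f x))"
proof -
  obtain C where C: "C \<ge> 0" "\<And>x. norm (L x) \<le> C * norm x"
    using bounded_linear.nonneg_bounded[OF L] by (auto simp: mult.commute)
  show ?thesis
  proof (rule half_integral_bounded_dominated[OF _ _ _ f f, of _ "C\<^sup>2"])
    fix x
    have "(norm (L (f x)))\<^sup>2 \<le> (C * norm (f x))\<^sup>2"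
      by (intro power_mono C) auto
    also have "\<dots> \<le> C\<^sup>2 * ((norm (f x))\<^sup>2 + (norm (f x))\<^sup>2)"
      by (simp add: power_mult_distrib mult_left_mono)
    finally show "(norm (L (f x)))\<^sup>2 \<le> C\<^sup>2 * ((norm (f x))\<^sup>2 + (norm (f x))\<^sup>2)" .
  qed (use cont bounded_linear.continuous_on[OF L cont] in
      \<open>auto intro: continuous_on_norm_power2\<close>)
qed

lemma half_L2_sum:
  fixes f :: "'i \<Rightarrow> real \<Rightarrow> complex^'m"
  assumes "finite I" "\<And>i. i \<in> I \<Longrightarrow> continuous_on UNIV (f i)" "\<And>i. i \<in> I \<Longrightarrow> half_L2 s x0 (f i)"
  shows "half_L2 s x0 (\<lambda>x. \<Sum>i\<in>I. c i *s f i x)"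
  using assms
proof (induction I rule: finite_induct)
  case empty
  show ?case by (auto simp: half_integral_bounded_def)
next
  case (insert i I)
  have "continuous_on UNIV (\<lambda>x. c j *s f j x)" if "j \<in> insert i I" for j
    using insert.prems(1)[OF that] by (rule bounded_linear.continuous_on[OF bounded_linear_smult_vec])
  then show ?case
    using insert by (simp) (intro half_L2_add half_L2_linear[OF bounded_linear_smult_vec] continuous_on_sum; simp)
qed

text \<open>Needed because a Weyl-Titchmarsh solution is only required to be square integrable
  itself, whereas membership in the Dirac solution space also constrains its
  quasi-derivative.\<close>

lemma first_order_system_half_L2:
  assumes sys: "first_order_system \<phi> 1 z f g"
    and herm: "AE x in lebesgue. hermitian (\<phi> x)"
    and f: "half_L2 s x0 f"
  shows "half_L2 s x0 g"
proof -
  note cont = first_order_system_continuous_on[OF sys]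
  define q where "q x = inner (f x) (g x)" for x
  have "ac_deriv q (\<lambda>x. inner (f x) (\<phi> x *v g x - z *s f x) + inner (1 *s g x - \<phi> x *v f x) (g x))"
    unfolding q_def[abs_def] using sys unfolding first_order_system_def
    by (intro ac_deriv_bilinear[OF bounded_bilinear_inner]) auto
  then have q: "ac_deriv q (\<lambda>x. (norm (g x))\<^sup>2 - Re z * (norm (f x))\<^sup>2)"
  proof (rule ac_deriv_cong)
    show "AE x in lebesgue. inner (f x) (\<phi> x *v g x - z *s f x) + inner (1 *s g x - \<phi> x *v f x) (g x)
        = (norm (g x))\<^sup>2 - Re z * (norm (f x))\<^sup>2"
      using herm
    proof eventually_elim
      case (elim x)
      have "inner (f x) (z *s f x) = Re z * (norm (f x))\<^sup>2"
        using inner_smult_smult_self[of 1 "f x" z] by simp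
      then show ?case
        by (simp add: inner_diff_left inner_diff_right hermitian_inner[OF elim] power2_norm_eq_inner)
    qed
  qed
  show ?thesis
  proof (rule half_line_derivative_bounded[where q = q and r = "Re z", OF _ _ _ _ f])
    show "((\<lambda>x. (norm (g x))\<^sup>2 - Re z * (norm (f x))\<^sup>2) has_integral q b - q a) {a..b}" if "a \<le> b" for a b
      by (rule ac_deriv_has_integral[OF q that])
    show "(q x)\<^sup>2 \<le> (norm (f x))\<^sup>2 * (norm (g x))\<^sup>2" for x
      using Cauchy_Schwarz_ineq[of "f x" "g x"] by (simp add: q_def power2_norm_eq_inner)
  qed (use cont in \<open>auto intro: continuous_on_norm_power2\<close>)
qed

text \<open>The form \<open>q\<close> has a derivative of constant sign, \<open>- Im \<zeta>\<close>
  times the energy density \<open>w\<close>, is dominated by \<open>w\<close>, and vanishes at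
  \<open>x0\<close>. Integrability of \<open>w\<close> then forces \<open>w x0 = 0\<close>.\<close>

lemma first_order_system_energy_zero:
  assumes sys: "first_order_system \<phi> \<zeta> \<zeta> f g"
    and herm: "AE x in lebesgue. hermitian (\<phi> x)" and "\<zeta> \<notin> \<real>"
    and L2: "half_L2 s x0 f" "half_L2 s x0 g" and "g x0 = 0"
  shows "f x0 = 0"
proof -
  note cont = first_order_system_continuous_on[OF sys]
  \<comment> \<open>The factor \<i> makes the real inner product see the imaginary part of the
    Hermitian one.\<close>
  define q where "q x = inner (\<i> *s f x) (g x)" for x
  define w where "w x = (norm (f x))\<^sup>2 + (norm (g x))\<^sup>2" for x
  have "ac_deriv q (\<lambda>x. inner (\<i> *s f x) (\<phi> x *v g x - \<zeta> *s f x)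
      + inner (\<i> *s (\<zeta> *s g x - \<phi> x *v f x)) (g x))"
    unfolding q_def[abs_def] using sys unfolding first_order_system_def
    by (intro ac_deriv_bilinear[OF bounded_bilinear_inner] ac_deriv_linear[OF bounded_linear_smult_vec]) auto
  then have q: "ac_deriv q (\<lambda>x. - Im \<zeta> * w x)"
  proof (rule ac_deriv_cong)
    show "AE x in lebesgue. inner (\<i> *s f x) (\<phi> x *v g x - \<zeta> *s f x)
        + inner (\<i> *s (\<zeta> *s g x - \<phi> x *v f x)) (g x) = - Im \<zeta> * w x"
      using herm
    proof eventually_elim
      case (elim x)
      have 1: "inner (\<i> *s f x) (\<zeta> *s f x) = Im \<zeta> * (norm (f x))\<^sup>2"
        by (simp add: inner_smult_smult_self)
      have 2: "inner (\<i> *s (\<zeta> *s g x)) (g x) = - Im \<zeta> * (norm (g x))\<^sup>2"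
        using inner_smult_smult_self[of "\<i> * \<zeta>" "g x" 1] by (simp add: vector_smult_assoc)
      have 3: "inner (\<i> *s (\<phi> x *v f x)) (g x) = inner (\<i> *s f x) (\<phi> x *v g x)"
        using hermitian_inner[OF elim, of "\<i> *s f x" "g x"] by (simp add: vector_scalar_commute)
      show ?case
        unfolding vector_ssub_ldistrib inner_diff_left inner_diff_right 1 2 3 w_def
        by (simp add: algebra_simps)
    qed
  qed
  have "w x0 = 0"
  proof (rule half_line_energy_zero[where w = w and q = q and c = "- Im \<zeta>" and s = s])
    show "continuous_on UNIV w" unfolding w_def[abs_def] using cont by (intro continuous_intros)
    show "half_integral_bounded s x0 w"
      by (rule half_integral_bounded_dominated[OF _ _ _ L2, of _ 1])
        (use cont in \<open>auto intro: continuous_on_norm_power2 continuous_on_add simp: w_def\<close>)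
    show "- Im \<zeta> \<noteq> 0" using \<open>\<zeta> \<notin> \<real>\<close> by (simp add: complex_is_Real_iff)
    show "((\<lambda>x. - Im \<zeta> * w x) has_integral q b - q a) {a..b}" if "a \<le> b" for a b
      by (rule ac_deriv_has_integral[OF q that])
    show "\<bar>q x\<bar> \<le> w x" for x
    proof -
      have "\<bar>q x\<bar> \<le> norm (f x) * norm (g x)"
        using Cauchy_Schwarz_ineq2[of "\<i> *s f x" "g x"] by (simp add: q_def norm_smult_vec)
      also have "\<dots> \<le> w x"
        using zero_le_power2[of "norm (f x) - norm (g x)"] zero_le_power2[of "norm (f x)"]
          zero_le_power2[of "norm (g x)"]
        unfolding w_def power2_diff by linarith
      finally show ?thesis .
    qed
    show "q x0 = 0" using \<open>g x0 = 0\<close> by (simp add: q_def)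
  qed (simp add: w_def)
  then show ?thesis by (simp add: w_def sum_power2_eq_zero_iff)
qed

subsection \<open>Dirac and Schroedinger solutions as first-order systems\<close>

text \<open>The set where two continuous functions differ is open, and a nonempty open set is not
  negligible.\<close>

lemma continuous_AE_eq_imp_eq:
  fixes f g :: "real \<Rightarrow> 'a::real_normed_vector"
  assumes "continuous_on UNIV f" "continuous_on UNIV g" "AE x in lebesgue. f x = g x"
  shows "f = g"
proof -
  obtain N where N: "negligible N" "{x. f x \<noteq> g x} \<subseteq> N"
    using assms(3) unfolding eventually_ae_filter_negligible by blast
  have "open {x. f x \<noteq> g x}" using assms(1,2) by (intro open_Collect_neq)
  then have "{x. f x \<noteq> g x} = {}"
    using open_not_negligible negligible_subset[OF N] by blast
  then show ?thesis by auto
qed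

lemma ac_deriv_sum:
  assumes "finite I" "I \<noteq> {}" "\<And>i. i \<in> I \<Longrightarrow> ac_deriv (f i) (f' i)"
  shows "ac_deriv (\<lambda>x. \<Sum>i\<in>I. f i x) (\<lambda>x. \<Sum>i\<in>I. f' i x)"
  using assms by (induction I rule: finite_ne_induct) (auto intro: ac_deriv_add)

section \<open>Linearity and algebra of columns and blocks\<close>

lemma bounded_linear_column: "bounded_linear (column k :: complex^'n^'m \<Rightarrow> complex^'m)"
  by (intro linear_conv_bounded_linear[THEN iffD1] linearI) (simp_all add: column_def vec_eq_iff)

lemma bounded_linear_upper: "bounded_linear (upper :: complex^('m + 'm) \<Rightarrow> complex^'m)"
  by (intro linear_conv_bounded_linear[THEN iffD1] linearI) (simp_all add: upper_def vec_eq_iff)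

lemma bounded_linear_lower: "bounded_linear (lower :: complex^('m + 'm) \<Rightarrow> complex^'m)"
  by (intro linear_conv_bounded_linear[THEN iffD1] linearI) (simp_all add: lower_def vec_eq_iff)

lemma bounded_linear_stack_left: "bounded_linear (\<lambda>u :: complex^'m. stack u 0)"
  by (intro linear_conv_bounded_linear[THEN iffD1] linearI) (simp_all add: stack_def vec_eq_iff split: sum.split)

lemma bounded_linear_stack_right: "bounded_linear (\<lambda>u :: complex^'m. stack 0 u)"
  by (intro linear_conv_bounded_linear[THEN iffD1] linearI) (simp_all add: stack_def vec_eq_iff split: sum.split)

lemma stack_eq_add: "stack u v = stack u 0 + stack 0 v" for u v :: "complex^'m"
  by (simp add: stack_def vec_eq_iff split: sum.split)

lemma upper_stack [simp]: "upper (stack A B) = A" and lower_stack [simp]: "lower (stack A B) = B"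
  by (simp_all add: upper_def lower_def stack_def)

lemma stack_upper_lower [simp]: "stack (upper A) (lower A) = A"
  by (simp add: upper_def lower_def stack_def vec_eq_iff split: sum.split)

lemma upper_matrix_vector_mult: "upper (A *v c) = upper A *v c"
  and lower_matrix_vector_mult: "lower (A *v c) = lower A *v c"
  by (simp_all add: upper_def lower_def matrix_vector_mult_def)

lemma column_matrix_mult: "column k (A ** B) = A *v column k B"
  by (simp add: column_def matrix_matrix_mult_def matrix_vector_mult_def vec_eq_iff)

lemma matrix_vector_mult_axis: "A *v axis k 1 = column k A" for A :: "complex^'n^'m"
  by (simp add: matrix_vector_mult_def axis_def column_def vec_eq_iff if_distrib cong: if_cong)

lemma column_mat_1: "column k (mat 1) = axis k 1"
  by (auto simp: column_def mat_def axis_def vec_eq_iff)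

lemma matrix_eq_iff_columns: "A = B \<longleftrightarrow> (\<forall>k. column k A = column k B)"
  by (auto simp: column_def vec_eq_iff)

lemma column_map_matrix_mult: "column k (map_matrix ((*) z) A) = z *s column k A" for A :: "complex^'n^'m"
  by (simp add: column_def vec_eq_iff)

text \<open>Reduces matrix solutions to vector solutions; conversely, a matrix is the sum of the
  embeddings \<open>E k\<close> of its columns.\<close>

lemma ac_deriv_matrix_iff:
  fixes F :: "real \<Rightarrow> complex^'n^'m"
  shows "ac_deriv F F' \<longleftrightarrow> (\<forall>k. ac_deriv (\<lambda>x. column k (F x)) (\<lambda>x. column k (F' x)))"
proof
  assume "\<forall>k. ac_deriv (\<lambda>x. column k (F x)) (\<lambda>x. column k (F' x))"
  define E :: "'n \<Rightarrow> complex^'m \<Rightarrow> complex^'n^'m" where "E k c = (\<chi> i j. if j = k then c $ i else 0)" for k c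
  have E: "bounded_linear (E k)" for k
    by (intro linear_conv_bounded_linear[THEN iffD1] linearI) (simp_all add: E_def vec_eq_iff)
  have sum: "(\<Sum>k\<in>UNIV. E k (column k A)) = A" for A
    by (simp add: vec_eq_iff E_def column_def)
  have "ac_deriv (\<lambda>x. \<Sum>k\<in>UNIV. E k (column k (F x))) (\<lambda>x. \<Sum>k\<in>UNIV. E k (column k (F' x)))"
    using \<open>\<forall>k. _\<close> by (intro ac_deriv_sum ac_deriv_linear[OF E]) auto
  then show "ac_deriv F F'" by (simp add: sum)
qed (auto intro: ac_deriv_linear bounded_linear_column)

text \<open>The off-diagonal form of the Dirac expression allows solving for the derivatives of the
  two blocks: its upper row determines that of \<open>lower\<close>, its lower row that of
  \<open>upper\<close>.\<close>

lemma dirac_solution_imp_first_order_system: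
  assumes "dirac_solution \<phi> \<zeta> UNIV V"
  shows "first_order_system \<phi> \<zeta> \<zeta> (\<lambda>x. upper (V x)) (\<lambda>x. lower (V x))"
proof -
  have ac: "loc_abs_cont_on UNIV V" and
    ae: "AE x in lebesgue. \<exists>V'. (V has_vector_derivative V') (at x) \<and> dirac_expr (\<phi> x) (V x) V' = \<zeta> *s V x"
    using assms by (simp_all add: dirac_solution_def)
  define V' where "V' x = stack (\<zeta> *s lower (V x) - \<phi> x *v upper (V x)) (\<phi> x *v lower (V x) - \<zeta> *s upper (V x))" for x
  have "AE x in lebesgue. (V has_vector_derivative V' x) (at x)"
    using ae
  proof eventually_elim
    case (elim x)
    then obtain W where W: "(V has_vector_derivative W) (at x)" "dirac_expr (\<phi> x) (V x) W = \<zeta> *s V x"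
      by blast
    have smult: "upper (\<zeta> *s V x) = \<zeta> *s upper (V x)" "lower (\<zeta> *s V x) = \<zeta> *s lower (V x)"
      by (simp_all add: upper_def lower_def vec_eq_iff)
    have "upper W = upper (V' x)" "lower W = lower (V' x)"
      using arg_cong[OF W(2), of upper] arg_cong[OF W(2), of lower]
      by (auto simp: dirac_expr_def V'_def smult algebra_simps)
    then have "W = V' x" by (metis stack_upper_lower)
    with W show ?case by simp
  qed
  with ac have V: "ac_deriv V V'" by (simp add: ac_deriv_def)
  show ?thesis
    using ac_deriv_linear[OF bounded_linear_upper V] ac_deriv_linear[OF bounded_linear_lower V]
    by (simp add: first_order_system_def V'_def)
qed

text \<open>Stated for an arbitrary set \<open>I\<close>, since a solution on the whole line must be
  recognized as a solution on a half-line.\<close>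

lemma first_order_system_imp_dirac_solution:
  assumes "first_order_system \<phi> \<zeta> \<zeta> f g"
  shows "dirac_solution \<phi> \<zeta> I (\<lambda>x. stack (f x) (g x))"
proof -
  define V where "V x = stack (f x) (g x)" for x
  define V' where "V' x = stack (\<zeta> *s g x - \<phi> x *v f x) (\<phi> x *v g x - \<zeta> *s f x)" for x
  have "ac_deriv (\<lambda>x. stack (f x) 0 + stack 0 (g x))
      (\<lambda>x. stack (\<zeta> *s g x - \<phi> x *v f x) 0 + stack 0 (\<phi> x *v g x - \<zeta> *s f x))"
    using assms unfolding first_order_system_def
    by (intro ac_deriv_add ac_deriv_linear[OF bounded_linear_stack_left] ac_deriv_linear[OF bounded_linear_stack_right]) auto
  then have V: "ac_deriv V V'" by (simp add: V_def[abs_def] V'_def[abs_def] flip: stack_eq_add)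
  then have "AE x in lebesgue. (V has_vector_derivative V' x) (at x)" by (simp add: ac_deriv_def)
  then have "AE x in lebesgue. x \<in> I \<longrightarrow> (\<exists>V'. (V has_vector_derivative V') (at x within I)
      \<and> dirac_expr (\<phi> x) (V x) V' = \<zeta> *s V x)"
  proof eventually_elim
    case (elim x)
    have "dirac_expr (\<phi> x) (V x) (V' x) = stack (\<zeta> *s f x) (\<zeta> *s g x)"
      by (simp add: dirac_expr_def V_def V'_def)
    also have "\<dots> = \<zeta> *s V x" by (simp add: V_def stack_def vec_eq_iff split: sum.split)
    finally show ?case using elim by (blast intro: has_vector_derivative_at_within)
  qed
  moreover have "loc_abs_cont_on I V" using V by (auto simp: ac_deriv_def loc_abs_cont_on_def)
  ultimately show ?thesis by (simp add: dirac_solution_def V_def[abs_def])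
qed

text \<open>The definition of the quasi-derivative is the first equation of the system, \<tau>_j u =
  z u is the second. The sign is absorbed into the potential, which becomes \<open>\<phi>\<close>
  for \<open>j = 1\<close> and its negative for \<open>j = 2\<close>.\<close>

lemma quasi_deriv_solution_iff_first_order_system:
  fixes \<phi> :: "real \<Rightarrow> complex^'m^'m"
  shows "is_quasi_deriv \<phi> j u v \<and>
        (AE x in lebesgue. \<exists>v'. (v has_vector_derivative v') (at x) \<and>
           - v' + (-1) ^ (j + 1) *\<^sub>R (\<phi> x ** v x) = map_matrix ((*) z) (u x))
    \<longleftrightarrow> (\<forall>k. first_order_system (\<lambda>x. (-1) ^ (j + 1) *\<^sub>R \<phi> x) 1 z (\<lambda>x. column k (u x)) (\<lambda>x. column k (v x)))"
proof -
  define c :: real where "c = (-1) ^ (j + 1)"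
  have 1: "is_quasi_deriv \<phi> j u v \<longleftrightarrow> loc_abs_cont_on UNIV v \<and> ac_deriv u (\<lambda>x. v x - c *\<^sub>R (\<phi> x ** u x))"
  proof -
    have "(\<exists>u'. (u has_vector_derivative u') (at x) \<and> v x = u' + c *\<^sub>R (\<phi> x ** u x))
      \<longleftrightarrow> (u has_vector_derivative v x - c *\<^sub>R (\<phi> x ** u x)) (at x)" for x
      by (metis add_diff_cancel_right' diff_add_cancel)
    then show ?thesis by (auto simp: is_quasi_deriv_def ac_deriv_def c_def)
  qed
  have 2: "(\<exists>v'. (v has_vector_derivative v') (at x) \<and> - v' + c *\<^sub>R (\<phi> x ** v x) = map_matrix ((*) z) (u x))
      \<longleftrightarrow> (v has_vector_derivative c *\<^sub>R (\<phi> x ** v x) - map_matrix ((*) z) (u x)) (at x)" for x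
  proof -
    have "- v' + a = b \<longleftrightarrow> v' = a - b" for v' a b :: "complex^'m^'m" by (auto simp: algebra_simps)
    then show ?thesis by simp
  qed
  have "is_quasi_deriv \<phi> j u v \<and>
        (AE x in lebesgue. \<exists>v'. (v has_vector_derivative v') (at x) \<and>
           - v' + (-1) ^ (j + 1) *\<^sub>R (\<phi> x ** v x) = map_matrix ((*) z) (u x))
    \<longleftrightarrow> ac_deriv u (\<lambda>x. v x - c *\<^sub>R (\<phi> x ** u x))
      \<and> ac_deriv v (\<lambda>x. c *\<^sub>R (\<phi> x ** v x) - map_matrix ((*) z) (u x))"
    unfolding c_def[symmetric] 1 2 by (auto simp: ac_deriv_def)
  also have "\<dots> \<longleftrightarrow> (\<forall>k. first_order_system (\<lambda>x. c *\<^sub>R \<phi> x) 1 z (\<lambda>x. column k (u x)) (\<lambda>x. column k (v x)))"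
  proof -
    have col: "column k (v x - c *\<^sub>R (\<phi> x ** u x)) = 1 *s column k (v x) - (c *\<^sub>R \<phi> x) *v column k (u x)"
      "column k (c *\<^sub>R (\<phi> x ** v x) - map_matrix ((*) z) (u x)) = (c *\<^sub>R \<phi> x) *v column k (v x) - z *s column k (u x)"
      for k x
      by (simp_all add: linear_diff[OF bounded_linear.linear[OF bounded_linear_column]]
          linear_scale[OF bounded_linear.linear[OF bounded_linear_column]] column_matrix_mult column_map_matrix_mult
          bounded_bilinear.scaleR_left[OF bounded_bilinear_matrix_vector_mult])
    show ?thesis
      unfolding ac_deriv_matrix_iff first_order_system_def col by blast
  qed
  finally show ?thesis unfolding c_def .
qed

text \<open>Gives the definite description in \<open>quasi_deriv\<close> its meaning: the defining
  formula fixes the quasi-derivative almost everywhere, continuity does the rest.\<close>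

lemma is_quasi_deriv_unique:
  assumes "is_quasi_deriv \<phi> j u v" "is_quasi_deriv \<phi> j u w"
  shows "v = w"
proof (rule continuous_AE_eq_imp_eq)
  show "continuous_on UNIV v" "continuous_on UNIV w"
    using assms by (auto simp: is_quasi_deriv_def intro: loc_abs_cont_on_UNIV_continuous_on)
  have "AE x in lebesgue. \<exists>u'. (u has_vector_derivative u') (at x) \<and> v x = u' + (-1) ^ (j + 1) *\<^sub>R (\<phi> x ** u x)"
    "AE x in lebesgue. \<exists>u'. (u has_vector_derivative u') (at x) \<and> w x = u' + (-1) ^ (j + 1) *\<^sub>R (\<phi> x ** u x)"
    using assms by (auto simp: is_quasi_deriv_def)
  then show "AE x in lebesgue. v x = w x"
    by eventually_elim (metis vector_derivative_unique_at)
qed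

lemma quasi_deriv_eqI: "is_quasi_deriv \<phi> j u v \<Longrightarrow> quasi_deriv \<phi> j u = v"
  unfolding quasi_deriv_def by (blast intro: is_quasi_deriv_unique)

section \<open>Matrix inverses and the Weyl-Titchmarsh data of the Schroedinger operators\<close>

lemma matrix_inv_inverse:
  fixes A :: "complex^'n^'n"
  assumes "invertible A"
  shows "A ** matrix_inv A = mat 1" "matrix_inv A ** A = mat 1"
  using someI_ex[OF assms[unfolded invertible_def]] unfolding matrix_inv_def by auto

lemma matrix_inv_unique:
  fixes A :: "complex^'n^'n"
  assumes "A ** B = mat 1"
  shows "matrix_inv A = B"
proof -
  have "B ** A = mat 1" using assms by (simp add: matrix_left_right_inverse)
  then have "invertible A" using assms unfolding invertible_def by blast
  from matrix_inv_inverse(2)[OF this] have "matrix_inv A ** (A ** B) = B"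
    by (simp add: matrix_mul_assoc)
  with assms show ?thesis by simp
qed

text \<open>Exposes the quasi-derivative \<open>v\<close>, which \<open>is_weyl_solution\<close>
  hides behind an existential quantifier, and replaces square integrability by bounded
  integrals.\<close>

definition weyl_system :: "(real \<Rightarrow> complex^'m^'m) \<Rightarrow> nat \<Rightarrow> line_end \<Rightarrow> complex \<Rightarrow> real
    \<Rightarrow> (real \<Rightarrow> complex^'m^'m) \<Rightarrow> (real \<Rightarrow> complex^'m^'m) \<Rightarrow> bool" where
  "weyl_system \<phi> j s z x0 \<psi> v \<longleftrightarrow>
     (\<forall>k. first_order_system (\<lambda>x. (-1) ^ (j + 1) *\<^sub>R \<phi> x) 1 z (\<lambda>x. column k (\<psi> x)) (\<lambda>x. column k (v x))) \<and>
     (\<forall>k. half_L2 s x0 (\<lambda>x. column k (\<psi> x))) \<and> \<psi> x0 = mat 1"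

lemma is_weyl_solution_iff: "is_weyl_solution \<phi> j s z x0 \<psi> \<longleftrightarrow> (\<exists>v. weyl_system \<phi> j s z x0 \<psi> v)"
proof -
  have "schroedinger_solution \<phi> j z \<psi> \<longleftrightarrow>
      (\<exists>v. \<forall>k. first_order_system (\<lambda>x. (-1) ^ (j + 1) *\<^sub>R \<phi> x) 1 z (\<lambda>x. column k (\<psi> x)) (\<lambda>x. column k (v x)))"
    unfolding schroedinger_solution_def quasi_deriv_solution_iff_first_order_system ..
  moreover have "square_integrable_on (half_line s x0) (\<lambda>x. column k (\<psi> x)) \<longleftrightarrow> half_L2 s x0 (\<lambda>x. column k (\<psi> x))"
    if "\<forall>k. first_order_system (\<lambda>x. (-1) ^ (j + 1) *\<^sub>R \<phi> x) 1 z (\<lambda>x. column k (\<psi> x)) (\<lambda>x. column k (v x))" for v k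
    using that by (intro square_integrable_on_half_line_iff) (blast dest: first_order_system_continuous_on(1))
  ultimately show ?thesis
    unfolding is_weyl_solution_def weyl_system_def by meson
qed

lemma weyl_function_eq:
  assumes "weyl_system \<phi> j s z x0 \<psi> v" "\<And>\<psi>'. is_weyl_solution \<phi> j s z x0 \<psi>' \<longleftrightarrow> \<psi>' = \<psi>"
  shows "weyl_function \<phi> j s z x0 = v x0"
proof -
  have "is_quasi_deriv \<phi> j \<psi> v"
    using assms(1) quasi_deriv_solution_iff_first_order_system[of \<phi> j \<psi> v z] by (auto simp: weyl_system_def)
  then show ?thesis by (simp add: weyl_function_def assms(2) quasi_deriv_eqI)
qed

text \<open>The equivalences for \<open>\<psi>\<close> assert existence and uniqueness at once,
  which justifies the definite description in \<open>weyl_function\<close>. Invertibility of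
  \<open>M\<close> is derived in the proof.\<close>

theorem theorem3p1:
  fixes \<phi> :: "real \<Rightarrow> complex^'m^'m"
    and x0 :: real
    and \<zeta> z :: complex
    and s :: line_end
    and \<Psi> :: "real \<Rightarrow> complex^('m + 'm)^('m + 'm)"
    and M :: "complex^'m^'m"
    and U :: "real \<Rightarrow> complex^'m^('m + 'm)"
  assumes phi_loc_integrable: "\<And>a b. \<phi> absolutely_integrable_on {a..b}"
    and phi_hermitian: "AE x in lebesgue. hermitian (\<phi> x)"
    and zeta_nonreal: "\<zeta> \<notin> \<real>"
    and z_eq: "z = \<zeta>\<^sup>2"
    and Psi: "dirac_fundamental \<phi> \<zeta> x0 \<Psi>"
    and M: "dirac_weyl_matrix \<phi> s \<zeta> x0 \<Psi> M"
    and U: "U = dirac_weyl_solution \<Psi> M"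
  shows "(\<forall>\<psi>. is_weyl_solution \<phi> 1 s z x0 \<psi> \<longleftrightarrow> \<psi> = (\<lambda>x. upper (U x)))
    \<and> (\<forall>\<psi>. is_weyl_solution \<phi> 2 s z x0 \<psi> \<longleftrightarrow> \<psi> = (\<lambda>x. lower (U x) ** matrix_inv M))
    \<and> weyl_function \<phi> 1 s z x0 = map_matrix ((*) \<zeta>) M
    \<and> weyl_function \<phi> 2 s z x0 = map_matrix ((*) (- \<zeta>)) (matrix_inv M)
    \<and> weyl_function \<phi> 1 s z x0 = map_matrix ((*) (- z)) (matrix_inv (weyl_function \<phi> 2 s z x0))"
proof -
  have \<zeta>0: "\<zeta> \<noteq> 0" using zeta_nonreal by auto
  have neg_hermitian: "AE x in lebesgue. hermitian (- \<phi> x)"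
    using phi_hermitian
    by eventually_elim (simp add: hermitian_def transpose_def vec_eq_iff)
  have U_x0: "U x0 = stack (mat 1) M"
    using Psi by (simp add: U dirac_weyl_solution_def dirac_fundamental_def)
  have x0: "x0 \<in> half_line s x0" by (cases s) auto

  \<comment> \<open>For constant \<open>c\<close>, the function \<open>U x *v c\<close> is a fixed
    linear combination of the columns of \<open>\<Psi> x\<close>.\<close>
  have sysU: "first_order_system \<phi> \<zeta> \<zeta> (\<lambda>x. upper (U x) *v c) (\<lambda>x. lower (U x) *v c)" for c
  proof -
    define d where "d = stack (mat 1) M *v c"
    have "U x *v c = (\<Sum>k\<in>UNIV. d $ k *s column k (\<Psi> x))" for x
      unfolding U dirac_weyl_solution_def d_def matrix_vector_mul_assoc[symmetric]
      by (rule matrix_mult_sum)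
    then have "upper (U x) *v c = (\<Sum>k\<in>UNIV. d $ k *s upper (column k (\<Psi> x)))"
      "lower (U x) *v c = (\<Sum>k\<in>UNIV. d $ k *s lower (column k (\<Psi> x)))" for x
      unfolding upper_matrix_vector_mult[symmetric] lower_matrix_vector_mult[symmetric]
      by (simp_all add: upper_def lower_def vec_eq_iff)
    moreover have "first_order_system \<phi> \<zeta> \<zeta> (\<lambda>x. upper (column k (\<Psi> x))) (\<lambda>x. lower (column k (\<Psi> x)))" for k
      using Psi by (intro dirac_solution_imp_first_order_system) (simp add: dirac_fundamental_def)
    ultimately show ?thesis by (simp add: first_order_system_sum)
  qed
  note contU = first_order_system_continuous_on[OF sysU]
  have L2U: "half_L2 s x0 (\<lambda>x. upper (U x) *v c)" "half_L2 s x0 (\<lambda>x. lower (U x) *v c)" for c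
  proof -
    have cont: "continuous_on UNIV (\<lambda>x. U x *v d)" for d
    proof -
      have "continuous_on UNIV (\<lambda>x. stack (upper (U x) *v d) 0 + stack 0 (lower (U x) *v d))"
        by (intro continuous_on_add bounded_linear.continuous_on[OF bounded_linear_stack_left]
            bounded_linear.continuous_on[OF bounded_linear_stack_right] contU)
      then show ?thesis
        by (simp flip: stack_eq_add upper_matrix_vector_mult lower_matrix_vector_mult)
    qed
    have col: "column k (U x) = U x *v axis k 1" for k x
      by (simp add: matrix_vector_mult_axis)
    have "half_L2 s x0 (\<lambda>x. column k (U x))" for k
    proof -
      have "continuous_on UNIV (\<lambda>x. column k (U x))" by (simp add: col cont)
      moreover have "square_integrable_on (half_line s x0) (\<lambda>x. column k (U x))"
        using M by (simp add: dirac_weyl_matrix_def dirac_l2_solutions_def U)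
      ultimately show ?thesis using square_integrable_on_half_line_iff by blast
    qed
    then have "half_L2 s x0 (\<lambda>x. \<Sum>k\<in>UNIV. c $ k *s column k (U x))"
      using cont by (intro half_L2_sum) (simp_all add: col)
    then have "half_L2 s x0 (\<lambda>x. U x *v c)" by (simp add: matrix_mult_sum)
    from half_L2_linear[OF bounded_linear_upper cont this] half_L2_linear[OF bounded_linear_lower cont this]
    show "half_L2 s x0 (\<lambda>x. upper (U x) *v c)" "half_L2 s x0 (\<lambda>x. lower (U x) *v c)"
      by (simp_all add: upper_matrix_vector_mult lower_matrix_vector_mult)
  qed

  \<comment> \<open>The solution \<open>U x *v c\<close> has initial blocks \<open>c\<close> and
    \<open>M *v c\<close>; if the second vanishes, the energy argument kills the first. So
    \<open>M\<close> is injective.\<close>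
  have "c = 0" if "M *v c = 0" for c
    using first_order_system_energy_zero[OF sysU phi_hermitian zeta_nonreal L2U, of c] that by (simp add: U_x0)
  then have "invertible M"
    by (simp add: invertible_left_inverse matrix_left_invertible_ker)
  note Minv = matrix_inv_inverse[OF this]

  \<comment> \<open>The spanning property of \<open>M\<close> gives such a \<open>c\<close> on the
    half-line only. The difference of the two solutions vanishes at \<open>x0\<close>, so uniqueness
    extends the identity to the whole line.\<close>
  have spanned: "\<exists>c. \<forall>x. f x = upper (U x) *v c \<and> g x = lower (U x) *v c"
    if sys: "first_order_system \<phi> \<zeta> \<zeta> f g" and L2: "half_L2 s x0 f" "half_L2 s x0 g" for f g
  proof -
    note cont = first_order_system_continuous_on[OF sys]
    have cont_stack: "continuous_on UNIV (\<lambda>x. stack (f x) 0)" "continuous_on UNIV (\<lambda>x. stack 0 (g x))"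
      using cont by (auto intro: bounded_linear.continuous_on[OF bounded_linear_stack_left]
          bounded_linear.continuous_on[OF bounded_linear_stack_right])
    have "half_L2 s x0 (\<lambda>x. stack (f x) (g x))"
      unfolding stack_eq_add[of "f _" "g _"]
      by (intro half_L2_add cont_stack half_L2_linear[OF bounded_linear_stack_left cont(1) L2(1)]
          half_L2_linear[OF bounded_linear_stack_right cont(2) L2(2)])
    moreover have "continuous_on UNIV (\<lambda>x. stack (f x) (g x))"
      unfolding stack_eq_add[of "f _" "g _"] by (intro continuous_on_add cont_stack)
    ultimately have "(\<lambda>x. stack (f x) (g x)) \<in> dirac_l2_solutions \<phi> s \<zeta> x0"
      by (simp add: dirac_l2_solutions_def square_integrable_on_half_line_iff
          first_order_system_imp_dirac_solution[OF sys])
    from bspec[OF conjunct2[OF M[unfolded dirac_weyl_matrix_def]] this]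
    obtain c where c: "\<And>x. x \<in> half_line s x0 \<Longrightarrow> stack (f x) (g x) = U x *v c"
      unfolding U by auto
    have init: "f x0 = upper (U x0) *v c" "g x0 = lower (U x0) *v c"
      using arg_cong[OF c[OF x0], of upper] arg_cong[OF c[OF x0], of lower]
      by (simp_all add: upper_matrix_vector_mult lower_matrix_vector_mult)
    have "first_order_system \<phi> \<zeta> \<zeta> (\<lambda>x. f x + (-1) *s (upper (U x) *v c)) (\<lambda>x. g x + (-1) *s (lower (U x) *v c))"
      by (intro first_order_system_add sys first_order_system_scale[OF sysU]) simp_all
    from first_order_system_unique[OF this phi_loc_integrable, of x0] show ?thesis
      by (auto simp: init vec_eq_iff)
  qed

  have W1: "weyl_system \<phi> 1 s z x0 (\<lambda>x. upper (U x)) (\<lambda>x. map_matrix ((*) \<zeta>) (lower (U x)))"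
  proof -
    have "first_order_system \<phi> 1 z (\<lambda>x. 1 *s (upper (U x) *v c)) (\<lambda>x. \<zeta> *s (lower (U x) *v c))" for c
      by (rule first_order_system_scale[OF sysU]) (simp_all add: z_eq power2_eq_square)
    from this[of "axis k 1" for k] L2U(1)[of "axis k 1" for k] show ?thesis
      by (simp add: weyl_system_def column_map_matrix_mult matrix_vector_mult_axis U_x0)
  qed
  have W1_unique: "\<psi> = (\<lambda>x. upper (U x))" if W: "weyl_system \<phi> 1 s z x0 \<psi> v" for \<psi> v
  proof -
    have "column k (\<psi> x) = column k (upper (U x))" for k x
    proof -
      have sys: "first_order_system \<phi> 1 z (\<lambda>x. column k (\<psi> x)) (\<lambda>x. column k (v x))"
        and L2: "half_L2 s x0 (\<lambda>x. column k (\<psi> x))" and init: "\<psi> x0 = mat 1"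
        using W by (simp_all add: weyl_system_def)
      have sys': "first_order_system \<phi> \<zeta> \<zeta> (\<lambda>x. 1 *s column k (\<psi> x)) (\<lambda>x. (1 / \<zeta>) *s column k (v x))"
        by (rule first_order_system_scale[OF sys]) (use \<zeta>0 in \<open>simp_all add: z_eq power2_eq_square\<close>)
      \<comment> \<open>Square integrability of the quasi-derivative is not part of the hypothesis
        on \<open>\<psi>\<close>; it comes from the half-line estimate.\<close>
      have "half_L2 s x0 (\<lambda>x. (1 / \<zeta>) *s column k (v x))"
        by (intro half_L2_linear[OF bounded_linear_smult_vec] first_order_system_half_L2[OF sys phi_hermitian L2]
            first_order_system_continuous_on[OF sys])
      with spanned[OF sys'] L2 obtain c where c: "\<And>x. column k (\<psi> x) = upper (U x) *v c"
        by auto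
      \<comment> \<open>The upper block of \<open>U x0\<close> is the identity, so the normalization
        of \<open>\<psi>\<close> identifies \<open>c\<close>.\<close>
      have "c = axis k 1"
        using c[of x0] by (simp add: U_x0 init column_mat_1)
      with c show ?thesis by (simp add: matrix_vector_mult_axis)
    qed
    then show ?thesis by (auto simp: matrix_eq_iff_columns)
  qed

  \<comment> \<open>The lower block of \<open>U x0\<close> is \<open>M\<close>, hence the
    normalizing factor \<open>matrix_inv M\<close>. Exchanging the blocks passes to the negated
    potential, as \<open>j = 2\<close> requires.\<close>
  have W2: "weyl_system \<phi> 2 s z x0 (\<lambda>x. lower (U x) ** matrix_inv M)
      (\<lambda>x. map_matrix ((*) (- \<zeta>)) (upper (U x) ** matrix_inv M))"
  proof -
    have "first_order_system (\<lambda>x. - \<phi> x) 1 z (\<lambda>x. 1 *s (lower (U x) *v c)) (\<lambda>x. (- \<zeta>) *s (upper (U x) *v c))" for c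
      by (rule first_order_system_scale[OF first_order_system_swap[OF sysU]]) (simp_all add: z_eq power2_eq_square)
    from this[of "column k (matrix_inv M)" for k] L2U(2)[of "column k (matrix_inv M)" for k] show ?thesis
      by (simp add: weyl_system_def column_map_matrix_mult column_matrix_mult U_x0 Minv)
  qed
  have W2_unique: "\<psi> = (\<lambda>x. lower (U x) ** matrix_inv M)" if W: "weyl_system \<phi> 2 s z x0 \<psi> v" for \<psi> v
  proof -
    have "column k (\<psi> x) = column k (lower (U x) ** matrix_inv M)" for k x
    proof -
      have sys: "first_order_system (\<lambda>x. - \<phi> x) 1 z (\<lambda>x. column k (\<psi> x)) (\<lambda>x. column k (v x))"
        and L2: "half_L2 s x0 (\<lambda>x. column k (\<psi> x))" and init: "\<psi> x0 = mat 1"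
        using W by (simp_all add: weyl_system_def)
      \<comment> \<open>The exchange yields parameters (-z, -1), and the factor
        \<open>- 1 / \<zeta>\<close> on the first component turns both into \<zeta>.\<close>
      have sys': "first_order_system \<phi> \<zeta> \<zeta> (\<lambda>x. (- 1 / \<zeta>) *s column k (v x)) (\<lambda>x. 1 *s column k (\<psi> x))"
        by (rule first_order_system_scale[OF first_order_system_swap[OF sys, simplified]])
          (use \<zeta>0 in \<open>simp_all add: z_eq power2_eq_square\<close>)
      have "half_L2 s x0 (\<lambda>x. (- 1 / \<zeta>) *s column k (v x))"
        by (intro half_L2_linear[OF bounded_linear_smult_vec] first_order_system_half_L2[OF sys neg_hermitian L2]
            first_order_system_continuous_on[OF sys])
      with spanned[OF sys'] L2 obtain c where c: "\<And>x. column k (\<psi> x) = lower (U x) *v c"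
        by auto
      have "axis k 1 = M *v c"
        using c[of x0] by (simp add: U_x0 init column_mat_1)
      then have "matrix_inv M *v axis k 1 = c"
        by (simp add: matrix_vector_mul_assoc Minv)
      then have "c = column k (matrix_inv M)" by (simp add: matrix_vector_mult_axis)
      with c show ?thesis by (simp add: column_matrix_mult)
    qed
    then show ?thesis by (auto simp: matrix_eq_iff_columns)
  qed

  have iff1: "is_weyl_solution \<phi> 1 s z x0 \<psi> \<longleftrightarrow> \<psi> = (\<lambda>x. upper (U x))" for \<psi>
    unfolding is_weyl_solution_iff using W1 W1_unique by blast
  have iff2: "is_weyl_solution \<phi> 2 s z x0 \<psi> \<longleftrightarrow> \<psi> = (\<lambda>x. lower (U x) ** matrix_inv M)" for \<psi>
    unfolding is_weyl_solution_iff using W2 W2_unique by blast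
  have m1: "weyl_function \<phi> 1 s z x0 = map_matrix ((*) \<zeta>) M"
    using weyl_function_eq[OF W1 iff1] by (simp add: U_x0)
  have m2: "weyl_function \<phi> 2 s z x0 = map_matrix ((*) (- \<zeta>)) (matrix_inv M)"
    using weyl_function_eq[OF W2 iff2] by (simp add: U_x0)
  \<comment> \<open>The inverse of the second Weyl-Titchmarsh function is \<open>M\<close> scaled by
    \<open>- 1 / \<zeta>\<close>; a further factor \<open>- z\<close> gives \<zeta> times
    \<open>M\<close>.\<close>
  have "map_matrix ((*) (- \<zeta>)) (matrix_inv M) ** map_matrix ((*) (- 1 / \<zeta>)) M = matrix_inv M ** M"
    using \<zeta>0 by (simp add: matrix_matrix_mult_def vec_eq_iff)
  then have inv: "matrix_inv (map_matrix ((*) (- \<zeta>)) (matrix_inv M)) = map_matrix ((*) (- 1 / \<zeta>)) M"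
    by (intro matrix_inv_unique) (simp add: Minv)
  have "map_matrix ((*) \<zeta>) M = map_matrix ((*) (- z)) (map_matrix ((*) (- 1 / \<zeta>)) M)"
    using \<zeta>0 by (simp add: vec_eq_iff z_eq power2_eq_square)
  with iff1 iff2 m1 m2 inv show ?thesis by simp
qed

end
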